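(* Let $a>0$ and $\eta\in(\frac23,1)$. For $p>1$ define \[ R_p(z):=\frac{a}{z-p}+\frac{p-p^{\eta}}{z-ip}+\frac{p-p^{\eta}}{z+ip}, \] where $i$ is the imaginary unit. Then there exists $p_0:=p_0(a,\eta)$ such that, for all $p>p_0$: (i) $R_p$ is a $3$-good rational function; (ii) the connected component of $\{z\in\hat{\mathbb{C}}:|R_p(z)|\ge 1\}$ containing $p$ has logarithmic capacity at least $a p^{1-\eta}/8$.
   Context: $\mathbb{D}=\{z\in\mathbb{C}:|z|<1\}$ and $\hat{\mathbb{C}}$ is the extended complex plane. A rational function $R$ is called $d$-good ($d\in\mathbb{N}$) if it has degree $d$, $R(\infty)=0$, and the open set $\Omega:=R^{-1}(\mathbb{D})\subset\hat{\mathbb{C}}$ is connected and bounded by $d$ disjoint analytic Jordan curves. The logarithmic capacity of a compact set $E\subset\mathbb{C}$ is $\mathrm{cap}(E)=e^{-I(E)}$, where $I(E)=\inf_\mu\iint\log\frac{1}{|z-w|}\,d\mu(z)\,d\mu(w)$, the infimum being over all Borel probability measures $\mu$ supported on $E$. *)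

theory Defs
  imports
    "HOL-Complex_Analysis.Complex_Analysis"
    "HOL-Computational_Algebra.Computational_Algebra"
    "HOL-Computational_Algebra.Field_as_Ring"
    "HOL-Probability.Probability"
begin

section \<open>Rational functions on the extended complex plane\<close>

text \<open>The extended complex plane is \<^typ>\<open>complex option\<close>, with \<^term>\<open>None\<close> as the point at infinity.\<close>

definition riemann_sphere :: "complex option topology" where
  "riemann_sphere = Alexandroff_compactification euclidean"

definition sphere_norm :: "complex option \<Rightarrow> ereal" where
  "sphere_norm w = (case w of None \<Rightarrow> \<infinity> | Some v \<Rightarrow> ereal (norm v))"

text \<open>Rational functions are elements of the fraction field of the polynomial ring;
  \<^const>\<open>quot_of_fract\<close> gives numerator and denominator in lowest terms.\<close>

type_synonym ratfun = "complex poly fract"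

definition rat_degree :: "ratfun \<Rightarrow> nat" where
  "rat_degree R = (case quot_of_fract R of (P, Q) \<Rightarrow> max (degree P) (degree Q))"

definition rat_eval :: "ratfun \<Rightarrow> complex option \<Rightarrow> complex option" where
  "rat_eval R z = (case quot_of_fract R of (P, Q) \<Rightarrow>
     (case z of
        None \<Rightarrow> if degree P \<le> degree Q then Some (coeff P (degree Q) / lead_coeff Q) else None
      | Some x \<Rightarrow> if poly Q x = 0 then None else Some (poly P x / poly Q x)))"

lemma rat_eval_Fract:
  assumes "poly Q z \<noteq> 0"
  shows "rat_eval (Fract P Q) (Some z) = Some (poly P z / poly Q z)"
proof -
  from assms have Q0: "Q \<noteq> 0" by auto
  obtain A B where AB: "quot_of_fract (Fract P Q) = (A, B)" by force
  have "B \<noteq> 0"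
    using AB snd_quot_of_fract_nonzero[of "Fract P Q"] by simp
  have "Fract A B = Fract P Q"
    using AB quot_to_fract_quot_of_fract[of "Fract P Q"] by (simp add: quot_to_fract_def)
  then have eq: "A * Q = P * B"
    using Q0 \<open>B \<noteq> 0\<close> by (simp add: eq_fract)
  have "coprime A B"
    using AB coprime_quot_of_fract[of "Fract P Q"] by simp
  then have "B dvd Q"
    using eq by (metis coprime_commute coprime_dvd_mult_right_iff dvd_triv_right)
  then have "poly B z \<noteq> 0" using assms by (auto elim!: dvdE)
  moreover have "poly A z * poly Q z = poly P z * poly B z"
    using arg_cong[OF eq, of "\<lambda>p. poly p z"] by simp
  ultimately show ?thesis
    using assms AB by (simp add: rat_eval_def field_simps)
qed

section \<open>Good rational functions\<close>

text \<open>A univalent map near the unit circle parametrises the curve. Only curves in the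
  finite plane are needed: infinity is an interior point of the domain below.\<close>

definition analytic_jordan_curve :: "complex set \<Rightarrow> bool" where
  "analytic_jordan_curve \<Gamma> \<longleftrightarrow>
     (\<exists>U f. open U \<and> sphere 0 1 \<subseteq> U \<and> f holomorphic_on U \<and> inj_on f U \<and> \<Gamma> = f ` sphere 0 1)"

definition lemniscate_domain :: "ratfun \<Rightarrow> complex option set" where
  "lemniscate_domain R = rat_eval R -` (Some ` ball 0 1)"

definition good_rational :: "nat \<Rightarrow> ratfun \<Rightarrow> bool" where
  "good_rational d R \<longleftrightarrow>
     rat_degree R = d \<and>
     rat_eval R None = Some 0 \<and>
     openin riemann_sphere (lemniscate_domain R) \<and>
     connectedin riemann_sphere (lemniscate_domain R) \<and>
     (\<exists>\<J>. finite \<J> \<and> card \<J> = d \<and> disjoint \<J> \<and> (\<forall>\<Gamma>\<in>\<J>. analytic_jordan_curve \<Gamma>) \<and>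
          riemann_sphere frontier_of lemniscate_domain R = Some ` \<Union>\<J>)"

section \<open>Logarithmic capacity\<close>

definition log_kernel :: "complex \<Rightarrow> complex \<Rightarrow> ereal" where
  "log_kernel z w = (if z = w then \<infinity> else ereal (ln (1 / norm (z - w))))"

text \<open>The integral is the difference of the integrals of the positive and negative parts
  (\<^const>\<open>e2ennreal\<close> truncates negative values to 0). For a probability measure on a compact set
  the kernel is bounded below, so the second integral is finite and the energy may be
  infinite.\<close>

definition log_energy :: "complex measure \<Rightarrow> ereal" where
  "log_energy \<mu> =
     enn2ereal (\<integral>\<^sup>+w. (\<integral>\<^sup>+z. e2ennreal (log_kernel z w) \<partial>\<mu>) \<partial>\<mu>) -
     enn2ereal (\<integral>\<^sup>+w. (\<integral>\<^sup>+z. e2ennreal (- log_kernel z w) \<partial>\<mu>) \<partial>\<mu>)"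

definition prob_measures_on :: "complex set \<Rightarrow> complex measure set" where
  "prob_measures_on E = {\<mu>. sets \<mu> = sets borel \<and> prob_space \<mu> \<and> emeasure \<mu> (- E) = 0}"

definition robin_constant :: "complex set \<Rightarrow> ereal" where
  "robin_constant E = (INF \<mu>\<in>prob_measures_on E. log_energy \<mu>)"

text \<open>Meant for compact sets, where the infimum is never \<open>- \<infinity>\<close>.\<close>

definition log_capacity :: "complex set \<Rightarrow> real" where
  "log_capacity E =
     (if robin_constant E = \<infinity> then 0 else exp (- real_of_ereal (robin_constant E)))"

section \<open>The family of rational functions\<close>

definition R_fam :: "real \<Rightarrow> real \<Rightarrow> real \<Rightarrow> ratfun" where
  "R_fam a \<eta> p =
     Fract [:of_real a:] [:- of_real p, 1:] +
     Fract [:of_real (p - p powr \<eta>):] [:- (\<i> * of_real p), 1:] +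
     Fract [:of_real (p - p powr \<eta>):] [:\<i> * of_real p, 1:]"

lemma rat_eval_R_fam:
  assumes "z \<noteq> of_real p" "z \<noteq> \<i> * of_real p" "z \<noteq> - \<i> * of_real p"
  shows "rat_eval (R_fam a \<eta> p) (Some z) =
     Some (of_real a / (z - of_real p) + of_real (p - p powr \<eta>) / (z - \<i> * of_real p) +
           of_real (p - p powr \<eta>) / (z + \<i> * of_real p))"
proof -
  have nz: "z - of_real p \<noteq> 0" "z - \<i> * of_real p \<noteq> 0" "z + \<i> * of_real p \<noteq> 0"
    using assms by (auto simp: add_eq_0_iff)
  define A B C where "A = [:- complex_of_real p, 1:]"
    and "B = [:- (\<i> * complex_of_real p), 1:]" and "C = [:\<i> * complex_of_real p, 1:]"
  have ABC0: "A \<noteq> 0" "B \<noteq> 0" "C \<noteq> 0" by (auto simp: A_def B_def C_def)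
  have v: "poly A z = z - of_real p" "poly B z = z - \<i> * of_real p" "poly C z = z + \<i> * of_real p"
    by (simp_all add: A_def B_def C_def algebra_simps)
  define k where "k = [:complex_of_real (p - p powr \<eta>):]"
  have "R_fam a \<eta> p = Fract (([:of_real a:] * B + k * A) * C + k * (A * B)) (A * B * C)"
    unfolding R_fam_def A_def[symmetric] B_def[symmetric] C_def[symmetric] k_def[symmetric]
    using ABC0 by simp
  moreover have "poly (A * B * C) z \<noteq> 0" using nz v by simp
  ultimately have "rat_eval (R_fam a \<eta> p) (Some z) =
     Some (poly (([:of_real a:] * B + k * A) * C + k * (A * B)) z / poly (A * B * C) z)"
    using rat_eval_Fract by metis
  then show ?thesis using nz by (simp add: v k_def add_divide_distrib distrib_right)
qed

end

theory Submission
  imports Defs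
begin

text \<open>
  Write \<open>R = P / Q\<close> in lowest terms, with \<open>deg P < deg Q = d\<close>. If no critical point of \<open>R\<close> lies in the
  compact set \<open>K = {|R| \<ge> 1}\<close>, then \<open>Q - v P\<close> has \<open>d\<close> simple roots for every \<open>v\<close> in some disc
  around \<open>0\<close> of radius larger than \<open>1\<close>, so \<open>Q / P\<close> is a \<open>d\<close>-sheeted covering of that disc. The disc is
  simply connected; hence the covering has \<open>d\<close> disjoint holomorphic sections, and \<open>K\<close> is the disjoint
  union of their images of the closed unit disc. By Janiszewski's theorem \<open>K\<close> does not separate the plane.

  For \<open>R\<^sub>p\<close> put \<open>z = p w\<close>, \<open>\<epsilon> = a / p\<close>, \<open>\<delta> = p\<^sup>\<eta>\<^sup>-\<^sup>1\<close>. The critical equation becomes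
  \<open>2 (1 - \<delta>) (w - 1)\<^sup>3 (w + 1) = - \<epsilon> (1 + w\<^sup>2)\<^sup>2\<close>, so one critical point is close to \<open>-1\<close> and three are
  at distance about \<open>\<epsilon>\<^sup>1\<^sup>/\<^sup>3\<close> from \<open>1\<close>; there \<open>|R\<^sub>p| \<le> 1 - \<delta> + O(\<epsilon>\<^sup>2\<^sup>/\<^sup>3) < 1\<close>.

  On the real segment from \<open>p\<close> to \<open>p + 3 a / (4 \<delta>)\<close> one has \<open>R\<^sub>p \<ge> 1\<close>. The energy of the uniform
  measure on a segment of length \<open>L\<close> shows that its capacity is at least \<open>L / (2 e) \<ge> L / 6\<close>.
\<close>

section \<open>Rational functions without critical points in the complement of the domain\<close>

lemma card_roots_rsquarefree:
  fixes p :: "complex poly"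
  assumes "rsquarefree p"
  shows "card {z. poly p z = 0} = degree p"
proof -
  have "p \<noteq> 0" using assms by (auto simp: rsquarefree_def)
  then have fin: "finite {z. poly p z = 0}" by (rule poly_roots_finite)
  have "degree p = degree (\<Prod>z | poly p z = 0. [:-z, 1:])"
    using complex_poly_decompose_rsquarefree[OF assms] \<open>p \<noteq> 0\<close>
    by (metis degree_smult_eq leading_coeff_0_iff)
  also have "\<dots> = (\<Sum>z | poly p z = 0. degree [:-z, 1:])"
    by (rule degree_prod_eq_sum_degree) auto
  finally show ?thesis by simp
qed

text \<open>The reciprocal Q / P is used because it is finite where |P| \<ge> |Q|; poles become
  zeros. The polynomial in \<open>noncritical\<close> is the numerator of its derivative. The margin
  \<rho> > 1 lets the sections below be univalent on a neighbourhood of the unit circle.\<close>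

locale noncritical_quotient =
  fixes P Q :: "complex poly" and \<rho> :: real
  assumes degree_less: "degree P < degree Q"
    and no_common_root: "\<And>z. poly Q z = 0 \<Longrightarrow> poly P z \<noteq> 0"
    and rho: "1 < \<rho>"
    and noncritical: "\<And>z. norm (poly Q z) < \<rho> * norm (poly P z) \<Longrightarrow>
      poly (pderiv Q * P - Q * pderiv P) z \<noteq> 0"
begin

definition f :: "complex \<Rightarrow> complex" where
  "f z = poly Q z / poly P z"

definition W :: "complex set" where
  "W = {z. norm (poly Q z) < \<rho> * norm (poly P z)}"

lemma P_nonzero: "z \<in> W \<Longrightarrow> poly P z \<noteq> 0"
  by (auto simp: W_def)

lemma open_W: "open W"
  unfolding W_def by (intro open_Collect_less continuous_intros)

lemma f_in_ball: "z \<in> W \<Longrightarrow> f z \<in> ball 0 \<rho>"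
  using P_nonzero[of z] by (auto simp: W_def f_def norm_divide field_simps)

text \<open>Turns fibres of \<open>f\<close> into root sets of polynomials. A zero of Q - v P cannot
  be a zero of P, since it would then be a common root.\<close>

lemma fibre: 
  assumes "v \<in> ball 0 \<rho>"
  shows "poly (Q - smult v P) z = 0 \<longleftrightarrow> z \<in> W \<and> f z = v"
proof
  assume "poly (Q - smult v P) z = 0"
  then have e: "poly Q z = v * poly P z" by simp
  have "poly P z \<noteq> 0" using no_common_root[of z] e by auto
  then show "z \<in> W \<and> f z = v"
    using assms e by (auto simp: W_def f_def norm_mult)
next
  assume "z \<in> W \<and> f z = v"
  then show "poly (Q - smult v P) z = 0"
    using P_nonzero[of z] by (auto simp: f_def)
qed

text \<open>The degree is independent of v, so no preimage escapes to infinity as v varies; this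
  takes the place of properness of \<open>f\<close>.\<close>

lemma degree_fibre: "degree (Q - smult v P) = degree Q"
  using degree_less by (metis degree_add_eq_left degree_minus degree_smult_le diff_conv_add_uminus le_less_trans)

lemma f_holomorphic: "f holomorphic_on W"
  unfolding f_def using P_nonzero by (intro holomorphic_intros) auto

lemma deriv_f:
  assumes "z \<in> W"
  shows "deriv f z \<noteq> 0"
proof -
  have "(f has_field_derivative
      (poly (pderiv Q) z * poly P z - poly Q z * poly (pderiv P) z) / (poly P z * poly P z)) (at z)"
    unfolding f_def using P_nonzero[OF assms] by (auto intro!: derivative_eq_intros)
  then show ?thesis
    using noncritical[of z] assms P_nonzero[OF assms] by (auto simp: W_def dest: DERIV_imp_deriv)
qed

text \<open>At a multiple root Q = v P and Q' = v P', hence Q' P - Q P' = 0, against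
  \<open>noncritical\<close>. So all roots are simple.\<close>

lemma card_fibre:
  assumes "v \<in> ball 0 \<rho>"
  shows "card {z \<in> W. f z = v} = degree Q"
proof -
  have "rsquarefree (Q - smult v P)"
    unfolding rsquarefree_roots
  proof (intro allI notI, elim conjE)
    fix z assume 0: "poly (Q - smult v P) z = 0" and 1: "poly (pderiv (Q - smult v P)) z = 0"
    have z: "norm (poly Q z) < \<rho> * norm (poly P z)" using fibre[OF assms] 0 by (simp add: W_def)
    have "poly (pderiv Q) z = v * poly (pderiv P) z" "poly Q z = v * poly P z"
      using 0 1 by (simp_all add: pderiv_diff pderiv_smult)
    then show False using noncritical[OF z] by simp
  qed
  from card_roots_rsquarefree[OF this] show ?thesis
    by (simp only: degree_fibre fibre[OF assms])
qed

lemma finite_fibre: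
  assumes "v \<in> ball 0 \<rho>"
  shows "finite {z \<in> W. f z = v}"
  by (rule card_ge_0_finite) (use card_fibre[OF assms] degree_less in simp)

text \<open>Pure counting: it shows that the sheets of the covering, and later its sections, miss no
  point.\<close>

lemma fibre_exhausted:
  fixes v :: complex
  assumes "v \<in> ball 0 \<rho>" "finite Z" "card Z = degree Q" "inj_on y Z"
    and "\<And>z. z \<in> Z \<Longrightarrow> y z \<in> W \<and> f (y z) = v"
    and "x \<in> W" "f x = v"
  shows "\<exists>z\<in>Z. x = y z"
proof -
  have "y ` Z = {z \<in> W. f z = v}"
    by (rule card_subset_eq) (use assms finite_fibre card_fibre in \<open>auto simp: card_image\<close>)
  then show ?thesis using assms(6,7) by blast
qed

text \<open>Around the points of a fibre there are disjoint balls on which \<open>f\<close> is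
  injective and open. Over the intersection of their images every value has one preimage in each
  ball, and by counting no others.\<close>

lemma covering_space_f: "covering_space W f (ball 0 \<rho>)"
proof
  show "continuous_on W f" using f_holomorphic by (rule holomorphic_on_imp_continuous_on)
  show "f ` W = ball 0 \<rho>"
  proof
    show "ball 0 \<rho> \<subseteq> f ` W"
    proof
      fix v :: complex assume "v \<in> ball 0 \<rho>"
      then have "card {z \<in> W. f z = v} > 0" using card_fibre degree_less by simp
      then have "{z \<in> W. f z = v} \<noteq> {}" by (metis card.empty less_irrefl)
      then show "v \<in> f ` W" by auto
    qed
  qed (use f_in_ball in auto)
next
  fix v0 :: complex assume v0: "v0 \<in> ball 0 \<rho>"
  define Z where "Z = {z \<in> W. f z = v0}"
  have Z: "finite Z" "card Z = degree Q" "Z \<subseteq> W"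
    using finite_fibre[OF v0] card_fibre[OF v0] by (auto simp: Z_def)
  obtain e where e: "e > 0" and sep: "\<And>x y. x \<in> Z \<Longrightarrow> y \<in> Z \<Longrightarrow> x \<noteq> y \<Longrightarrow> 2 * e \<le> dist x y"
  proof
    \<comment> \<open>The element 1 keeps the set nonempty when \<open>Z\<close> is a single
      point.\<close>
    let ?D = "insert 1 ((\<lambda>(x,y). dist x y) ` {(x,y). x \<in> Z \<and> y \<in> Z \<and> x \<noteq> y})"
    have fin: "finite ?D"
      by (intro finite.insertI finite_imageI, rule finite_subset[of _ "Z \<times> Z"]) (use Z in auto)
    show "Min ?D / 2 > 0" using fin by (auto simp: Min_gr_iff)
    show "2 * (Min ?D / 2) \<le> dist x y" if "x \<in> Z" "y \<in> Z" "x \<noteq> y" for x y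
    proof -
      have "dist x y \<in> ?D" using that by auto
      then have "Min ?D \<le> dist x y" using fin Min_le by blast
      then show ?thesis by simp
    qed
  qed
  have "\<exists>r>0. ball z r \<subseteq> W \<inter> ball z e \<and> open (f ` ball z r) \<and> inj_on f (ball z r)" if "z \<in> Z" for z
  proof -
    have "f holomorphic_on W \<inter> ball z e" "z \<in> W \<inter> ball z e" "open (W \<inter> ball z e)" "deriv f z \<noteq> 0"
      using that Z e open_W deriv_f f_holomorphic by (auto intro: holomorphic_on_subset)
    then show ?thesis using has_complex_derivative_locally_invertible by metis
  qed
  then obtain r where r: "\<And>z. z \<in> Z \<Longrightarrow> r z > 0 \<and> ball z (r z) \<subseteq> W \<inter> ball z e \<and>
      open (f ` ball z (r z)) \<and> inj_on f (ball z (r z))"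
    by metis
  \<comment> \<open>All sheets are cut back to one common base, so that each \<open>u z\<close> maps
    onto \<open>T\<close>.\<close>
  define T where "T = ball 0 \<rho> \<inter> (\<Inter>z\<in>Z. f ` ball z (r z))"
  define u where "u z = ball z (r z) \<inter> f -` T" for z
  have "open T" unfolding T_def using Z r by (intro open_Int open_INT) auto
  have uW: "u z \<subseteq> W" if "z \<in> Z" for z using r[OF that] by (auto simp: u_def)
  have disj: "ball x (r x) \<inter> ball y (r y) = {}" if "x \<in> Z" "y \<in> Z" "x \<noteq> y" for x y
  proof -
    have "ball x e \<inter> ball y e = {}"
      by (rule disjoint_ballI) (use sep[OF that] in simp)
    then show ?thesis using r that by blast
  qed
  have openu: "open (u z)" if "z \<in> Z" for z
    unfolding u_def by (intro continuous_open_preimage \<open>open T\<close>)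
      (use r[OF that] f_holomorphic in \<open>auto intro!: holomorphic_on_imp_continuous_on intro: holomorphic_on_subset\<close>)
  have "\<exists>q. homeomorphism (u z) T f q" if "z \<in> Z" for z
  proof -
    have hol: "f holomorphic_on u z" using f_holomorphic uW[OF that] by (rule holomorphic_on_subset)
    have opn: "open (u z)" using openu[OF that] .
    have inj: "inj_on f (u z)" using r[OF that] by (auto simp: u_def intro: inj_on_subset)
    have "T \<subseteq> f ` ball z (r z)" using that by (auto simp: T_def)
    then have im: "f ` u z = T" by (auto simp: u_def)
    obtain q where q: "q holomorphic_on f ` u z" "\<And>x. x \<in> u z \<Longrightarrow> q (f x) = x"
      using holomorphic_has_inverse[OF hol opn inj] by metis
    have "continuous_on (u z) f" "continuous_on T q"
      using hol q(1) by (auto simp: im intro: holomorphic_on_imp_continuous_on)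
    moreover have "q ` T = u z" using q(2) by (force simp: im[symmetric])
    moreover have "f (q y) = y" if "y \<in> T" for y
      using that q(2) unfolding im[symmetric] by auto
    ultimately have "homeomorphism (u z) T f q" using q(2) im by (simp add: homeomorphism_def)
    then show ?thesis by - (rule exI[of _ q])
  qed
  moreover have "\<Union> (u ` Z) = W \<inter> f -` T"
  proof
    \<comment> \<open>The value f x has one preimage in each of the disjoint balls; these are
      \<open>degree Q\<close> many, so x is one of them.\<close>
    show "W \<inter> f -` T \<subseteq> \<Union> (u ` Z)"
    proof
      fix x assume x: "x \<in> W \<inter> f -` T"
      have "\<exists>y. y \<in> ball z (r z) \<and> f y = f x" if "z \<in> Z" for z
      proof -
        have "f x \<in> f ` ball z (r z)" using x that by (simp add: T_def)
        then show ?thesis by (auto simp del: mem_ball)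
      qed
      then obtain y where y: "\<And>z. z \<in> Z \<Longrightarrow> y z \<in> ball z (r z) \<and> f (y z) = f x" by metis
      have "inj_on y Z"
      proof (rule inj_onI, rule ccontr)
        fix s t assume st: "s \<in> Z" "t \<in> Z" "y s = y t" "s \<noteq> t"
        have "y s \<in> ball s (r s) \<inter> ball t (r t)" using y[OF st(1)] y[OF st(2)] st(3) by simp
        then show False using disj[OF st(1,2,4)] by simp
      qed
      moreover have "y z \<in> W \<and> f (y z) = f x" if "z \<in> Z" for z using y[OF that] r[OF that] by auto
      ultimately have "\<exists>z\<in>Z. x = y z"
        by (intro fibre_exhausted[of "f x"]) (use f_in_ball[of x] Z x in auto)
      then obtain z where "z \<in> Z" "x = y z" by blast
      then have "x \<in> u z" using y[of z] x by (simp add: u_def)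
      then show "x \<in> \<Union> (u ` Z)" using \<open>z \<in> Z\<close> by blast
    qed
  qed (use uW in \<open>auto simp: u_def\<close>)
  moreover have "pairwise disjnt (u ` Z)"
    using disj by (fastforce simp: pairwise_def disjnt_def u_def)
  moreover have "v0 \<in> T"
    using v0 r by (force simp: T_def Z_def)
  moreover have "openin (top_of_set (ball 0 \<rho>)) T"
    using \<open>open T\<close> by (auto simp: T_def intro: open_subset)
  moreover have "\<forall>U\<in>u ` Z. openin (top_of_set W) U"
    using openu uW by (auto intro!: open_subset)
  ultimately show "\<exists>T. v0 \<in> T \<and> openin (top_of_set (ball 0 \<rho>)) T \<and>
      (\<exists>v. \<Union>v = W \<inter> f -` T \<and> (\<forall>u\<in>v. openin (top_of_set W) u) \<and> pairwise disjnt v \<and>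
        (\<forall>u\<in>v. \<exists>q. homeomorphism u T f q))"
    by (intro exI[of _ T] conjI exI[of _ "u ` Z"] ballI; (elim imageE)?; simp)
qed

text \<open>The disc is simply connected, so its identity map lifts through the covering, once for
  every starting point r over 0. Lifts that agree at one point agree at 0, hence have the same r.
  Counting shows that the lifts exhaust \<open>W\<close>.\<close>

lemma holomorphic_sections:
  obtains g where
    "\<forall>r. poly Q r = 0 \<longrightarrow> g r holomorphic_on ball 0 \<rho>"
    "\<forall>r v. poly Q r = 0 \<longrightarrow> v \<in> ball 0 \<rho> \<longrightarrow> g r v \<in> W \<and> f (g r v) = v"
    "\<forall>r s v. poly Q r = 0 \<longrightarrow> poly Q s = 0 \<longrightarrow> v \<in> ball 0 \<rho> \<longrightarrow> g r v = g s v \<longrightarrow> r = s"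
    "\<forall>z\<in>W. \<exists>r. poly Q r = 0 \<and> z = g r (f z)"
proof -
  have rho0: "(0::complex) \<in> ball 0 \<rho>" using rho by simp
  have root: "r \<in> W \<and> f r = 0" if "poly Q r = 0" for r
    using fibre[OF rho0, of r] that by simp
  have "\<exists>g. continuous_on (ball 0 \<rho>) g \<and> g \<in> ball 0 \<rho> \<rightarrow> W \<and> g 0 = r \<and> (\<forall>v\<in>ball 0 \<rho>. f (g v) = v)"
    if "poly Q r = 0" for r
    by (rule covering_space_lift_strong[OF covering_space_f, of r 0 "ball 0 \<rho>" "\<lambda>v. v"])
      (use root[OF that] rho0 in \<open>auto simp: convex_imp_simply_connected open_imp_locally_path_connected\<close>)
  then obtain g where g: "\<And>r. poly Q r = 0 \<Longrightarrow> continuous_on (ball 0 \<rho>) (g r) \<and> g r \<in> ball 0 \<rho> \<rightarrow> W \<and> g r 0 = r \<and> (\<forall>v\<in>ball 0 \<rho>. f (g r v) = v)"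
    by metis
  have inW: "g r v \<in> W \<and> f (g r v) = v" if "poly Q r = 0" "v \<in> ball 0 \<rho>" for r v
    using g[OF that(1)] that(2) by blast
  have inj: "r = s" if "poly Q r = 0" "poly Q s = 0" "v \<in> ball 0 \<rho>" "g r v = g s v" for r s v
  proof -
    have "g r 0 = g s 0"
      by (rule covering_space_lift_unique[OF covering_space_f, of "g r" v "g s" "ball 0 \<rho>" "\<lambda>v. v"])
        (use g that rho0 in auto)
    then show ?thesis using g that by metis
  qed
  have "g r holomorphic_on ball 0 \<rho>" if "poly Q r = 0" for r
    by (rule covering_space_lift_is_holomorphic[OF covering_space_f open_W f_holomorphic, of "\<lambda>v. v"])
      (use g[OF that] in auto)
  moreover have "\<exists>r. poly Q r = 0 \<and> z = g r (f z)" if "z \<in> W" for z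
  proof -
    let ?Z = "{z \<in> W. f z = 0}"
    have Z: "?Z = {r. poly Q r = 0}" using fibre[OF rho0] by simp
    have "\<exists>r\<in>?Z. z = g r (f z)"
      by (rule fibre_exhausted[of "f z"])
        (use that Z inW inj[OF _ _ f_in_ball] f_in_ball finite_fibre[OF rho0] card_fibre[OF rho0]
          in \<open>auto simp: inj_on_def\<close>)
    then show ?thesis using Z by auto
  qed
  ultimately show ?thesis using that[of g] inW inj by blast
qed

lemma lemniscate_structure:
  obtains \<J> where "finite \<J>" "card \<J> = degree Q" "disjoint \<J>"
    "\<forall>\<Gamma>\<in>\<J>. analytic_jordan_curve \<Gamma>"
    "\<Union>\<J> = {z. norm (poly Q z) = norm (poly P z)}"
    "\<Union>\<J> \<subseteq> closure {z. norm (poly P z) < norm (poly Q z)}"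
    "connected {z. norm (poly P z) < norm (poly Q z)}"
proof -
  obtain g where sections:
    "\<forall>r. poly Q r = 0 \<longrightarrow> g r holomorphic_on ball 0 \<rho>"
    "\<forall>r v. poly Q r = 0 \<longrightarrow> v \<in> ball 0 \<rho> \<longrightarrow> g r v \<in> W \<and> f (g r v) = v"
    "\<forall>r s v. poly Q r = 0 \<longrightarrow> poly Q s = 0 \<longrightarrow> v \<in> ball 0 \<rho> \<longrightarrow> g r v = g s v \<longrightarrow> r = s"
    "\<forall>z\<in>W. \<exists>r. poly Q r = 0 \<and> z = g r (f z)"
    by (rule holomorphic_sections)
  note hol = sections(1)[rule_format] and g = sections(2)[rule_format]
    and inj = sections(3)[rule_format] and ex = sections(4)[rule_format]
  define Z where "Z = {r. poly Q r = 0}"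
  have rho0: "(0::complex) \<in> ball 0 \<rho>" using rho by simp
  have "Z = {z \<in> W. f z = 0}" using fibre[OF rho0] by (simp add: Z_def)
  then have Z: "finite Z" "card Z = degree Q"
    using finite_fibre[OF rho0] card_fibre[OF rho0] by auto
  have norm_f: "norm (f z) = norm (poly Q z) / norm (poly P z)" for z
    by (simp add: f_def norm_divide)
  \<comment> \<open>Since \<open>f\<close> recovers the parameter, a common point of two images has
    the same parameter in both, which forces r = s.\<close>
  have disj: "g r ` S \<inter> g s ` S = {}" if "r \<in> Z" "s \<in> Z" "r \<noteq> s" "S \<subseteq> ball 0 \<rho>" for r s S
  proof -
    have False if v: "v \<in> S" "w \<in> S" "g r v = g s w" for v w
    proof -
      have vb: "v \<in> ball 0 \<rho>" and wb: "w \<in> ball 0 \<rho>" using v \<open>S \<subseteq> ball 0 \<rho>\<close> by auto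
      have rs: "poly Q r = 0" "poly Q s = 0" using \<open>r \<in> Z\<close> \<open>s \<in> Z\<close> by (simp_all add: Z_def)
      have "f (g r v) = v" "f (g s w) = w" using g[OF rs(1) vb] g[OF rs(2) wb] by simp_all
      then have "v = w" using v(3) by simp
      then show False using inj[OF rs vb] v(3) \<open>r \<noteq> s\<close> by simp
    qed
    then show ?thesis by blast
  qed
  have inj_g: "inj_on (g r) (ball 0 \<rho>)" if "r \<in> Z" for r
    by (rule inj_on_inverseI[of _ f]) (use g that in \<open>auto simp: Z_def\<close>)
  have cont: "continuous_on (ball 0 \<rho>) (g r)" if "r \<in> Z" for r
    using hol that by (auto simp: Z_def intro: holomorphic_on_imp_continuous_on)
  have sub: "cball 0 1 \<subseteq> ball (0::complex) \<rho>" "sphere 0 1 \<subseteq> ball (0::complex) \<rho>" using rho by auto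
  have image_eq: "(\<Union>r\<in>Z. g r ` S) = {z\<in>W. f z \<in> S}" if "S \<subseteq> ball 0 \<rho>" for S
  proof
    show "(\<Union>r\<in>Z. g r ` S) \<subseteq> {z\<in>W. f z \<in> S}" using g that by (auto simp: Z_def subset_iff)
    show "{z\<in>W. f z \<in> S} \<subseteq> (\<Union>r\<in>Z. g r ` S)" using ex by (fastforce simp: Z_def)
  qed
  have in_W: "z \<in> W \<and> poly P z \<noteq> 0" if "norm (poly Q z) \<le> norm (poly P z)" for z
  proof -
    have "poly P z \<noteq> 0" using no_common_root[of z] that by auto
    then have "norm (poly P z) < \<rho> * norm (poly P z)" using rho by simp
    then have "norm (poly Q z) < \<rho> * norm (poly P z)" using that by linarith
    then show ?thesis using \<open>poly P z \<noteq> 0\<close> by (simp add: W_def)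
  qed
  have K: "(\<Union>r\<in>Z. g r ` cball 0 1) = {z. norm (poly Q z) \<le> norm (poly P z)}"
    using in_W P_nonzero by (auto simp: image_eq[OF sub(1)] norm_f field_simps)
  have L: "(\<Union>r\<in>Z. g r ` sphere 0 1) = {z. norm (poly Q z) = norm (poly P z)}"
    using in_W P_nonzero by (auto simp: image_eq[OF sub(2)] norm_f)
  let ?J = "(\<lambda>r. g r ` sphere 0 1) ` Z"
  show ?thesis
  proof
    show "finite ?J" using Z by simp
    have "inj_on (\<lambda>r. g r ` sphere 0 1) Z"
    proof (rule inj_onI, rule ccontr)
      fix r s assume rs: "r \<in> Z" "s \<in> Z" "g r ` sphere 0 1 = g s ` sphere 0 1" "r \<noteq> s"
      have "g r 1 \<in> g r ` sphere 0 1" by auto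
      then show False using disj[OF rs(1,2,4) sub(2)] rs(3) by auto
    qed
    then show "card ?J = degree Q" using Z by (simp add: card_image)
    show "disjoint ?J" using disj[OF _ _ _ sub(2)] by (auto simp: disjoint_def)
    show "\<forall>\<Gamma>\<in>?J. analytic_jordan_curve \<Gamma>"
    proof
      fix \<Gamma> assume "\<Gamma> \<in> ?J"
      then obtain r where r: "r \<in> Z" "\<Gamma> = g r ` sphere 0 1" by blast
      then show "analytic_jordan_curve \<Gamma>"
        unfolding analytic_jordan_curve_def using hol[of r] inj_g[of r] sub(2) open_ball
        by (intro exI[of _ "ball 0 \<rho>"] exI[of _ "g r"]) (simp add: Z_def)
    qed
    show "\<Union>?J = {z. norm (poly Q z) = norm (poly P z)}" using L by simp
    show "\<Union>?J \<subseteq> closure {z. norm (poly P z) < norm (poly Q z)}"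
    proof
      fix z assume "z \<in> \<Union>?J"
      then obtain r v where r: "r \<in> Z" and v: "norm v = 1" and z: "z = g r v" by auto
      show "z \<in> closure {z. norm (poly P z) < norm (poly Q z)}"
        unfolding closure_approachable
      proof (intro allI impI)
        fix e :: real assume "e > 0"
        have "v \<in> ball 0 \<rho>" using v rho by simp
        then obtain d where d: "d > 0" "\<And>x. x \<in> ball 0 \<rho> \<Longrightarrow> dist x v < d \<Longrightarrow> dist (g r x) z < e"
          using cont[OF r] \<open>e > 0\<close> unfolding continuous_on_iff z by blast
        \<comment> \<open>Moving v outward to (1 + t) v gives |f| = 1 + t > 1, so z is a limit of
          points with |P| < |Q|. The two bounds on t keep the parameter within the continuity radius
          and inside the disc of radius \<rho>.\<close>
        define t where "t = min (d / 2) ((\<rho> - 1) / 2)"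
        have t: "0 < t" "t < d" "1 + t < \<rho>" using d rho by (auto simp: t_def min_def field_simps)
        let ?x = "of_real (1 + t) * v"
        have nx: "norm ?x = 1 + t" using t v by (simp only: norm_mult norm_of_real) simp
        have "?x - v = of_real t * v" by (simp add: algebra_simps)
        then have "dist ?x v < d" using t v by (simp add: dist_norm norm_mult)
        moreover have xb: "?x \<in> ball 0 \<rho>" using nx t by simp
        ultimately have "dist (g r ?x) z < e" using d by blast
        moreover have "norm (f (g r ?x)) = 1 + t" "poly P (g r ?x) \<noteq> 0"
          using g[of r ?x] r xb nx P_nonzero by (auto simp: Z_def)
        then have "norm (poly P (g r ?x)) < norm (poly Q (g r ?x))"
          using t by (simp add: norm_f field_simps)
        ultimately show "\<exists>y\<in>{z. norm (poly P z) < norm (poly Q z)}. dist y z < e" by blast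
      qed
    qed
    have disc: "compact (g r ` cball 0 1) \<and> connected (- (g r ` cball 0 1))" if r: "r \<in> Z" for r
    proof
      have c: "continuous_on (cball 0 1) (g r)" using cont[OF r] sub(1) by (rule continuous_on_subset)
      then show "compact (g r ` cball 0 1)" by (intro compact_continuous_image) auto
      have "cball (0::complex) 1 homeomorphic g r ` cball 0 1"
        using homeomorphic_compact[OF _ c refl] inj_on_subset[OF inj_g[OF r] sub(1)] by simp
      then have "g r ` cball 0 1 homeomorphic cball (0::complex) 1" by (rule homeomorphic_sym[THEN iffD1])
      then show "connected (- (g r ` cball 0 1))"
        by (rule connected_complement_homeomorphic_convex_compact) auto
    qed
    \<comment> \<open>One disc is added at a time. Janiszewski's theorem applies because the new
      disc is disjoint from the earlier ones and the empty intersection is connected.\<close>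
    have "compact (\<Union>r\<in>Y. g r ` cball 0 1) \<and> connected (- (\<Union>r\<in>Y. g r ` cball 0 1))"
      if "Y \<subseteq> Z" for Y
      using finite_subset[OF that Z(1)] that
    proof (induction Y rule: finite_induct)
      case (insert r Y)
      have "g r ` cball 0 1 \<inter> (\<Union>s\<in>Y. g s ` cball 0 1) = {}"
        using disj[OF _ _ _ sub(1)] insert.hyps insert.prems by blast
      then show ?case
        using insert disc[of r] Janiszewski_connected[of "g r ` cball 0 1" "\<Union>s\<in>Y. g s ` cball 0 1"]
        by (auto simp: compact_Un compact_imp_closed)
    qed (simp add: connected_UNIV)
    from this[OF order_refl] show "connected {z. norm (poly P z) < norm (poly Q z)}"
      by (simp add: K Collect_neg_eq[symmetric] not_le)
  qed
qed

end

section \<open>Behaviour at infinity and fractions in lowest terms\<close>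

lemma eventually_norm_poly_less:
  fixes P Q :: "complex poly"
  assumes "degree P < degree Q"
  shows "eventually (\<lambda>z. c * norm (poly P z) < norm (poly Q z)) at_infinity"
proof -
  have "((\<lambda>z. poly P z / poly Q z) \<longlongrightarrow> 0) at_infinity"
    using assms by (rule poly_divide_tendsto_0_at_infinity)
  then have "eventually (\<lambda>z. norm (poly P z / poly Q z) < 1 / (\<bar>c\<bar> + 1)) at_infinity"
    by (auto simp: tendsto_iff dist_norm)
  moreover have "eventually (\<lambda>z. poly Q z \<noteq> 0) at_infinity"
    using assms by (intro filterlim_at_infinity_imp_eventually_ne filterlim_poly_at_infinity) auto
  ultimately show ?thesis
  proof eventually_elim
    case (elim z)
    then have "(\<bar>c\<bar> + 1) * norm (poly P z) < norm (poly Q z)"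
      by (simp add: norm_divide field_simps)
    moreover have "c * norm (poly P z) \<le> (\<bar>c\<bar> + 1) * norm (poly P z)"
      by (intro mult_right_mono) auto
    ultimately show ?case by simp
  qed
qed

lemma compact_lemniscate:
  fixes P Q :: "complex poly"
  assumes "degree P < degree Q"
  shows "compact {z. norm (poly Q z) \<le> c * norm (poly P z)}"
proof -
  obtain b where "\<And>z. norm z \<ge> b \<Longrightarrow> c * norm (poly P z) < norm (poly Q z)"
    using eventually_norm_poly_less[OF assms, of c] by (auto simp: eventually_at_infinity)
  then have "bounded {z. norm (poly Q z) \<le> c * norm (poly P z)}"
    by (intro boundedI[of _ b]) (metis linorder_not_le mem_Collect_eq nle_le)
  moreover have "closed {z. norm (poly Q z) \<le> c * norm (poly P z)}"
    by (intro closed_Collect_le continuous_intros)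
  ultimately show ?thesis by (simp add: compact_eq_bounded_closed)
qed

text \<open>By the fundamental theorem of algebra a common divisor without roots is constant, so P
  and Q are coprime. A monic denominator is the normal form chosen by
  \<open>quot_of_fract\<close>.\<close>

lemma quot_of_fract_Fract:
  fixes P Q :: "complex poly"
  assumes "lead_coeff Q = 1" and "\<And>z. poly Q z = 0 \<Longrightarrow> poly P z \<noteq> 0"
  shows "quot_of_fract (Fract P Q) = (P, Q)"
proof -
  have "coprime P Q"
  proof (rule coprimeI)
    fix D assume D: "D dvd P" "D dvd Q"
    have "poly D z \<noteq> 0" for z using D assms(2)[of z] by (auto elim!: dvdE)
    then have "degree D = 0"
      using fundamental_theorem_of_algebra_alt[of D] by (metis degree_pCons_0)
    then show "is_unit D" using D assms(1)
      by (metis dvd_0_left_iff is_unit_iff_degree leading_coeff_0_iff zero_neq_one)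
  qed
  then have "(P, Q) \<in> normalized_fracts"
    using assms(1) by (simp add: normalized_fracts_def unit_factor_poly_def one_pCons)
  moreover have "Fract P Q = quot_to_fract (P, Q)"
    using assms(1) by (auto simp: quot_to_fract_def)
  ultimately show ?thesis by (simp add: quot_of_fract_quot_to_fract')
qed

lemma rat_eval_Fract_coprime:
  fixes P Q :: "complex poly"
  assumes "lead_coeff Q = 1" and "\<And>z. poly Q z = 0 \<Longrightarrow> poly P z \<noteq> 0"
  shows "rat_eval (Fract P Q) (Some z) = (if poly Q z = 0 then None else Some (poly P z / poly Q z))"
  by (simp add: rat_eval_def quot_of_fract_Fract[OF assms])

section \<open>The Riemann sphere\<close>

lemma openin_insert_None:
  assumes "compact K"
  shows "openin riemann_sphere (insert None (Some ` (- K)))"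
  unfolding riemann_sphere_def openin_Alexandroff_compactification
  using assms by (auto simp: Compl_eq_Diff_UNIV compact_imp_closed)

lemma openin_riemann_sphere_image_Some: "openin riemann_sphere (Some ` U) \<longleftrightarrow> open U"
  by (simp add: riemann_sphere_def)

lemma closedin_riemann_sphere_image_Some: "closedin riemann_sphere (Some ` K) \<longleftrightarrow> compact K"
  by (auto simp: riemann_sphere_def dest: compact_imp_closed)

lemma topspace_riemann_sphere: "topspace riemann_sphere = UNIV"
proof -
  have "x \<in> insert None (range Some)" for x :: "complex option" by (cases x) auto
  then show ?thesis by (auto simp: riemann_sphere_def)
qed

lemma continuous_map_Some_riemann_sphere: "continuous_map euclidean riemann_sphere Some"
  unfolding riemann_sphere_def by (rule continuous_map_Some)

lemma open_vimage_Some: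
  assumes "openin riemann_sphere T"
  shows "open {w. Some w \<in> T}"
  using openin_continuous_map_preimage[OF continuous_map_Some_riemann_sphere assms] by simp

text \<open>Adjoining a limit point preserves connectedness. A neighbourhood of infinity has compact
  complement, which together with K is bounded and cannot cover the plane.\<close>

lemma connectedin_insert_None:
  assumes "compact K" "connected (- K)"
  shows "connectedin riemann_sphere (insert None (Some ` (- K)))"
proof (rule connectedin_intermediate_closure_of)
  show "connectedin riemann_sphere (Some ` (- K))"
    using assms(2) by (intro connectedin_continuous_map_image[OF continuous_map_Some_riemann_sphere]) simp
  have "None \<in> riemann_sphere closure_of (Some ` (- K))"
    unfolding in_closure_of
  proof (intro conjI allI impI)
    show "None \<in> topspace riemann_sphere" by (simp add: topspace_riemann_sphere)
    fix T assume T: "None \<in> T \<and> openin riemann_sphere T"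
    then have "compact {w. Some w \<notin> T}"
      unfolding riemann_sphere_def openin_Alexandroff_compactification by (auto simp: image_iff)
    then have "bounded ({w. Some w \<notin> T} \<union> K)" using assms(1) by (simp add: compact_imp_bounded)
    then have "{w. Some w \<notin> T} \<union> K \<noteq> UNIV" using not_bounded_UNIV by metis
    then show "\<exists>y. y \<in> Some ` (- K) \<and> y \<in> T" by auto
  qed
  moreover have "Some ` (- K) \<subseteq> riemann_sphere closure_of (Some ` (- K))"
    by (rule closure_of_subset) (simp add: topspace_riemann_sphere)
  ultimately show "insert None (Some ` (- K)) \<subseteq> riemann_sphere closure_of (Some ` (- K))" by simp
qed auto

text \<open>Infinity is interior to this open set and so contributes no frontier point; at finite
  points the sphere has the topology of the plane.\<close>

lemma frontier_of_insert_None: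
  assumes "compact K"
  shows "riemann_sphere frontier_of (insert None (Some ` (- K))) = Some ` frontier K"
proof -
  have "Some z \<in> riemann_sphere closure_of (insert None (Some ` (- K))) \<longleftrightarrow> z \<in> closure (- K)" for z
  proof
    assume z: "Some z \<in> riemann_sphere closure_of (insert None (Some ` (- K)))"
    show "z \<in> closure (- K)"
    proof (rule ccontr)
      assume "z \<notin> closure (- K)"
      then have "Some z \<in> Some ` (- closure (- K))" by simp
      moreover have "openin riemann_sphere (Some ` (- closure (- K)))"
        by (simp add: openin_riemann_sphere_image_Some open_Compl)
      ultimately obtain y where "y \<in> insert None (Some ` (- K))" "y \<in> Some ` (- closure (- K))"
        using z unfolding in_closure_of by metis
      then show False using closure_subset[of "- K"] by auto
    qed
  next
    assume z: "z \<in> closure (- K)"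
    show "Some z \<in> riemann_sphere closure_of (insert None (Some ` (- K)))"
      unfolding in_closure_of
    proof (intro conjI allI impI)
      fix T assume T: "Some z \<in> T \<and> openin riemann_sphere T"
      then have "{w. Some w \<in> T} \<inter> - K \<noteq> {}"
        using z open_Int_closure_eq_empty[OF open_vimage_Some, of T "- K"] by auto
      then show "\<exists>y. y \<in> insert None (Some ` (- K)) \<and> y \<in> T" by auto
    qed (simp add: topspace_riemann_sphere)
  qed
  moreover have "frontier K = closure (- K) \<inter> K"
    using assms by (simp add: frontier_closures compact_imp_closed Int_commute)
  moreover have "x \<in> Some ` A \<longleftrightarrow> (\<exists>z. x = Some z \<and> z \<in> A)" for x and A :: "complex set"
    by auto
  ultimately show ?thesis
    unfolding frontier_of_openin[OF openin_insert_None[OF assms]]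
    by (intro set_eqI; case_tac x; simp)
qed

section \<open>Good rational functions\<close>

text \<open>The hypothesis excludes critical points only where |Q| \<le> |P|. Compactness extends
  this to |Q| < \<rho> |P| for some \<rho> > 1, as \<open>noncritical_quotient\<close>
  requires.\<close>

theorem good_rational_Fract:
  fixes P Q :: "complex poly"
  assumes degree: "degree P < degree Q" and monic: "lead_coeff Q = 1"
    and no_common_root: "\<And>z. poly Q z = 0 \<Longrightarrow> poly P z \<noteq> 0"
    and noncritical: "\<And>z. norm (poly Q z) \<le> norm (poly P z) \<Longrightarrow>
      poly (pderiv Q * P - Q * pderiv P) z \<noteq> 0"
  shows "good_rational (degree Q) (Fract P Q)"
proof -
  note qf = quot_of_fract_Fract[OF monic no_common_root]
  define N where "N = {z. norm (poly P z) < norm (poly Q z)}"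
  define K where "K = {z. norm (poly Q z) \<le> norm (poly P z)}"
  have NK: "N = - K" by (auto simp: N_def K_def)
  have "compact K" unfolding K_def using compact_lemniscate[OF degree, of 1] by simp
  have "\<exists>\<rho>>1. \<forall>z. norm (poly Q z) < \<rho> * norm (poly P z) \<longrightarrow>
      poly (pderiv Q * P - Q * pderiv P) z \<noteq> 0"
  proof -
    \<comment> \<open>These critical points are the only obstruction to a radius up to 2. On this
      compact set |Q / P| exceeds 1, so its minimum does too.\<close>
    define C where "C = {z. norm (poly Q z) \<le> 2 * norm (poly P z)} \<inter>
      {z. poly (pderiv Q * P - Q * pderiv P) z = 0}"
    have "compact C" unfolding C_def
      by (intro compact_Int_closed compact_lemniscate[OF degree] closed_Collect_eq continuous_intros)
    have C: "norm (poly P z) < norm (poly Q z) \<and> poly P z \<noteq> 0" if "z \<in> C" for z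
      using noncritical[of z] that by (force simp: C_def not_le)
    show ?thesis
    proof (cases "C = {}")
      case True
      then show ?thesis unfolding C_def by (intro exI[of _ 2]) (auto intro: less_imp_le)
    next
      case False
      have "continuous_on C (\<lambda>z. norm (poly Q z) / norm (poly P z))"
        using C by (intro continuous_intros) auto
      from continuous_attains_inf[OF \<open>compact C\<close> False this] obtain m where m: "m \<in> C"
        "\<And>z. z \<in> C \<Longrightarrow> norm (poly Q m) / norm (poly P m) \<le> norm (poly Q z) / norm (poly P z)"
        by blast
      let ?\<rho> = "min 2 (norm (poly Q m) / norm (poly P m))"
      have "?\<rho> > 1" using C[OF m(1)] by (simp add: field_simps)
      moreover have "poly (pderiv Q * P - Q * pderiv P) z \<noteq> 0"
        if z: "norm (poly Q z) < ?\<rho> * norm (poly P z)" for z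
      proof
        assume 0: "poly (pderiv Q * P - Q * pderiv P) z = 0"
        have "?\<rho> * norm (poly P z) \<le> 2 * norm (poly P z)" by (intro mult_right_mono) auto
        then have "z \<in> C" using z 0 by (simp add: C_def)
        then have le: "?\<rho> \<le> norm (poly Q z) / norm (poly P z)" using m(2)[of z] by linarith
        have pos: "norm (poly P z) > 0" using C[OF \<open>z \<in> C\<close>] by simp
        show False using z le[unfolded pos_le_divide_eq[OF pos]] by linarith
      qed
      ultimately show ?thesis by blast
    qed
  qed
  then obtain \<rho> where "noncritical_quotient P Q \<rho>"
    using degree no_common_root by (auto simp: noncritical_quotient_def)
  then obtain \<J> where J: "finite \<J>" "card \<J> = degree Q" "disjoint \<J>"
    "\<forall>\<Gamma>\<in>\<J>. analytic_jordan_curve \<Gamma>"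
    "\<Union>\<J> = {z. norm (poly Q z) = norm (poly P z)}" "\<Union>\<J> \<subseteq> closure N" "connected N"
    unfolding N_def by (rule noncritical_quotient.lemniscate_structure)
  have dom: "lemniscate_domain (Fract P Q) = insert None (Some ` N)"
  proof (rule set_eqI)
    fix x
    show "x \<in> lemniscate_domain (Fract P Q) \<longleftrightarrow> x \<in> insert None (Some ` N)"
    proof (cases x)
      case None
      have "coeff P (degree Q) = 0" using degree by (simp add: coeff_eq_0)
      then show ?thesis using None degree by (simp add: lemniscate_domain_def rat_eval_def qf)
    next
      case (Some z)
      then show ?thesis using no_common_root[of z]
        by (auto simp: lemniscate_domain_def rat_eval_def qf N_def norm_divide field_simps split: if_splits)
    qed
  qed
  have "frontier N = \<Union>\<J>"
  proof
    have "open N" unfolding N_def by (intro open_Collect_less continuous_intros)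
    moreover have "closure N \<subseteq> {z. norm (poly P z) \<le> norm (poly Q z)}"
      unfolding N_def by (intro closure_minimal closed_Collect_le continuous_intros) auto
    ultimately show "frontier N \<subseteq> \<Union>\<J>"
      unfolding J(5) by (auto simp: frontier_def interior_open N_def)
    show "\<Union>\<J> \<subseteq> frontier N"
      using J(6) \<open>open N\<close> unfolding J(5) by (auto simp: frontier_def interior_open N_def)
  qed
  then have "riemann_sphere frontier_of lemniscate_domain (Fract P Q) = Some ` \<Union>\<J>"
    using \<open>compact K\<close> by (simp add: dom NK frontier_of_insert_None frontier_complement)
  moreover have "openin riemann_sphere (lemniscate_domain (Fract P Q))"
    using \<open>compact K\<close> by (simp add: dom NK openin_insert_None)
  moreover have "connectedin riemann_sphere (lemniscate_domain (Fract P Q))"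
    using \<open>compact K\<close> \<open>connected N\<close> by (simp add: dom NK connectedin_insert_None)
  moreover have "rat_degree (Fract P Q) = degree Q" "rat_eval (Fract P Q) None = Some 0"
    using degree monic by (simp_all add: rat_degree_def rat_eval_def qf coeff_eq_0)
  ultimately show ?thesis
    unfolding good_rational_def using J(1-4) by (intro conjI exI[of _ \<J>])
qed

section \<open>Components of the complement of the domain\<close>

lemma lemniscate_component:
  fixes P Q :: "complex poly"
  assumes degree: "degree P < degree Q" and monic: "lead_coeff Q = 1"
    and no_common_root: "\<And>z. poly Q z = 0 \<Longrightarrow> poly P z \<noteq> 0"
    and S: "connected S" "c \<in> S" "\<And>z. z \<in> S \<Longrightarrow> norm (poly Q z) \<le> norm (poly P z)"
  defines "E \<equiv> {z. Some z \<in> connected_component_of_set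
      (subtopology riemann_sphere {x. sphere_norm (rat_eval (Fract P Q) x) \<ge> 1}) (Some c)}"
  shows "compact E" "S \<subseteq> E"
proof -
  define K where "K = {z. norm (poly Q z) \<le> norm (poly P z)}"
  have X: "{x. sphere_norm (rat_eval (Fract P Q) x) \<ge> 1} = Some ` K"
  proof (rule set_eqI)
    fix x
    show "x \<in> {x. sphere_norm (rat_eval (Fract P Q) x) \<ge> 1} \<longleftrightarrow> x \<in> Some ` K"
    proof (cases x)
      case None
      then show ?thesis using degree monic
        by (auto simp: rat_eval_def quot_of_fract_Fract[OF monic no_common_root] coeff_eq_0 sphere_norm_def)
    next
      case (Some z)
      then show ?thesis using no_common_root[of z]
        by (auto simp: rat_eval_Fract_coprime[OF monic no_common_root] sphere_norm_def K_def
            norm_divide one_ereal_def field_simps)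
    qed
  qed
  let ?Y = "subtopology riemann_sphere (Some ` K)"
  let ?comp = "connected_component_of_set ?Y (Some c)"
  have E: "E = {z. Some z \<in> ?comp}" by (simp add: E_def X)
  have "compact K" unfolding K_def using compact_lemniscate[OF degree, of 1] by simp
  then have "closedin riemann_sphere (Some ` K)" by (simp add: closedin_riemann_sphere_image_Some)
  \<comment> \<open>A component is closed in its space, and a closed subset of the sphere that
    avoids infinity is compact in the plane.\<close>
  then have "closedin riemann_sphere ?comp"
    by (rule closedin_trans_full[OF closedin_connected_component_of])
  moreover have "?comp \<subseteq> Some ` K"
    using connected_component_of_subset_topspace[of ?Y "Some c"] by auto
  then have "?comp = Some ` E" unfolding E by auto
  ultimately show "compact E" by (simp add: closedin_riemann_sphere_image_Some)
  have "connectedin riemann_sphere (Some ` S)"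
    using S(1) by (intro connectedin_continuous_map_image[OF continuous_map_Some_riemann_sphere]) simp
  then have "connectedin ?Y (Some ` S)"
    using S(3) by (auto simp: connectedin_subtopology K_def)
  then have "Some ` S \<subseteq> ?comp"
    using S(2) by (intro connected_component_of_maximal) auto
  then show "S \<subseteq> E" unfolding E by auto
qed

section \<open>Capacity of a segment\<close>

lemma nn_integral_ln_ge_1:
  assumes "1 \<le> b"
  shows "(\<integral>\<^sup>+x. ennreal (ln x) * indicator {1..b} x \<partial>lborel) = ennreal (b * ln b - b + 1)"
proof -
  have "(\<integral>\<^sup>+x. ennreal (ln x) * indicator {1..b} x \<partial>lborel) =
      ennreal ((b * ln b - b) - (1 * ln 1 - 1))"
    by (rule nn_integral_FTC_Icc)
      (use assms in \<open>auto intro!: derivative_eq_intros simp: has_real_derivative_iff_has_vector_derivative[symmetric]\<close>)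
  then show ?thesis by simp
qed

lemma nn_integral_neg_ln_le_1:
  "(\<integral>\<^sup>+x. ennreal (- ln x) * indicator {0..1} x \<partial>lborel) = 1"
proof -
  \<comment> \<open>The integrand is unbounded at 0 but its antiderivative extends continuously, so
    the fundamental theorem is applied with derivatives in the interior only.\<close>
  have "continuous_on {0..1} (\<lambda>x::real. x - x * ln x)"
    unfolding continuous_on_eq_continuous_within
  proof
    fix x :: real assume x: "x \<in> {0..1}"
    show "continuous (at x within {0..1}) (\<lambda>x. x - x * ln x)"
    proof (cases "x = 0")
      case True
      have "((\<lambda>x::real. x - x * ln x) \<longlongrightarrow> 0) (at_right 0)" by real_asymp
      moreover have "at (0::real) within {0..1} = at_right 0" by (rule at_within_Icc_at_right) simp
      ultimately show ?thesis using True by (simp add: continuous_within)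
    next
      case False
      then show ?thesis using x by (intro continuous_intros) auto
    qed
  qed
  moreover have "((\<lambda>x::real. x - x * ln x) has_vector_derivative - ln x) (at x)" if "x \<in> {0<..<1}" for x
    unfolding has_real_derivative_iff_has_vector_derivative[symmetric]
    using that by (auto intro!: derivative_eq_intros)
  ultimately have "((\<lambda>x::real. - ln x) has_integral ((1 - 1 * ln 1) - (0 - 0 * ln 0))) {0..1}"
    by (intro fundamental_theorem_of_calculus_interior) auto
  then have "((\<lambda>x::real. - ln x) has_integral 1) {0..1}" by simp
  then show ?thesis
    by (subst nn_integral_has_integral_lebesgue'[where I = 1])
      (auto simp: ln_le_zero_iff intro: order.strict_implies_order split: if_splits
        dest: le_imp_less_or_eq)
qed

text \<open>A trial measure for the infimum in \<open>robin_constant\<close>: an upper bound on its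
  energy gives a lower bound on capacity.\<close>

definition segment_measure :: "complex \<Rightarrow> real \<Rightarrow> complex measure" where
  "segment_measure c L = distr (uniform_measure lborel {0..L}) borel (\<lambda>t. c + of_real t)"

lemma prob_space_segment_measure: "0 < L \<Longrightarrow> prob_space (segment_measure c L)"
  unfolding segment_measure_def
  by (intro prob_space.prob_space_distr prob_space_uniform_measure) auto

lemma AE_segment_measure:
  assumes "0 < L"
  shows "AE w in segment_measure c L. w \<in> (\<lambda>t. c + of_real t) ` {0..L}"
proof -
  have "closed ((\<lambda>t. c + complex_of_real t) ` {0..L})"
    by (intro compact_imp_closed compact_continuous_image continuous_intros) auto
  then have "{w \<in> space borel. w \<in> (\<lambda>t. c + complex_of_real t) ` {0..L}} \<in> sets borel" by simp
  moreover have "AE t in uniform_measure lborel {0..L}. t \<in> {0..L}"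
    by (rule AE_uniform_measureI) auto
  ultimately show ?thesis
    unfolding segment_measure_def by (subst AE_distr_iff) (auto elim!: AE_mp)
qed

lemma nn_integral_segment_measure:
  assumes "0 < L" and [measurable]: "F \<in> borel_measurable borel"
  shows "(\<integral>\<^sup>+z. F z \<partial>segment_measure c L) =
    (\<integral>\<^sup>+t. F (c + of_real t) * indicator {0..L} t \<partial>lborel) / ennreal L"
  unfolding segment_measure_def using assms(1)
  by (subst nn_integral_distr) (auto simp: nn_integral_uniform_measure)

lemma borel_measurable_log_kernel [measurable]: "(\<lambda>z. log_kernel z w) \<in> borel_measurable borel"
  unfolding log_kernel_def by measurable

lemma log_kernel_segment:
  assumes "s \<noteq> t"
  shows "log_kernel (c + of_real t) (c + of_real s) = ereal (- ln \<bar>t - s\<bar>)"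
proof -
  have "c + complex_of_real t - (c + of_real s) = of_real (t - s)" by simp
  then have "norm (c + complex_of_real t - (c + of_real s)) = \<bar>t - s\<bar>" by (metis norm_of_real)
  then show ?thesis using assms by (simp add: log_kernel_def ln_div)
qed

text \<open>The kernel is positive only within distance 1 of s, and each side of s contributes at
  most 1, the integral of -ln over the unit interval. The density is 1 / L.\<close>

lemma positive_potential_le:
  assumes "0 < L"
  shows "(\<integral>\<^sup>+z. e2ennreal (log_kernel z (c + of_real s)) \<partial>segment_measure c L) \<le> ennreal (2 / L)"
proof -
  define h :: "real \<Rightarrow> ennreal" where "h x = ennreal (- ln x) * indicator {0..1} x" for x
  have [measurable]: "h \<in> borel_measurable borel" unfolding h_def by measurable
  have h: "(\<integral>\<^sup>+x. h x \<partial>lborel) = 1" unfolding h_def by (rule nn_integral_neg_ln_le_1)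
  \<comment> \<open>The diagonal, where the kernel is infinite, is a null set. The arguments of
    \<open>h\<close> below have the shape expected by
    \<open>nn_integral_real_affine\<close>.\<close>
  have "AE t in lborel. t \<noteq> s" by (rule AE_lborel_singleton)
  then have "(\<integral>\<^sup>+t. e2ennreal (log_kernel (c + of_real t) (c + of_real s)) * indicator {0..L} t \<partial>lborel)
      \<le> (\<integral>\<^sup>+t. h (- s + 1 * t) + h (s + (- 1) * t) \<partial>lborel)"
  proof (intro nn_integral_mono_AE, eventually_elim)
    case (elim t)
    have "e2ennreal (log_kernel (c + of_real t) (c + of_real s)) = ennreal (- ln \<bar>t - s\<bar>)"
      using log_kernel_segment[of s t c] elim by (simp add: ennreal_def)
    moreover have "ennreal (- ln \<bar>t - s\<bar>) \<le> h (- s + 1 * t) + h (s + (- 1) * t)"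
      by (cases "\<bar>t - s\<bar> \<le> 1"; cases "s < t") (use elim in \<open>auto simp: h_def ennreal_neg\<close>)
    ultimately show ?case by (auto simp: indicator_def)
  qed
  also have "\<dots> = 2"
    using nn_integral_real_affine[of h 1 "- s"] nn_integral_real_affine[of h "- 1" s]
    by (subst nn_integral_add) (auto simp: h)
  finally show ?thesis
    using assms divide_right_mono_ennreal[of _ 2 "ennreal L"]
    by (subst nn_integral_segment_measure) (auto simp: divide_ennreal[symmetric])
qed

text \<open>The convex function b ln b - b lies above its tangent at m.\<close>

lemma tangent_line_le_mult_ln:
  fixes b m :: real
  assumes "0 < b" "0 < m"
  shows "b * ln m - m \<le> b * ln b - b"
proof -
  have "b * ln (m / b) \<le> b * (m / b - 1)"
    using assms by (intro mult_left_mono ln_le_minus_one) auto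
  then show ?thesis using assms by (simp add: ln_div algebra_simps)
qed

text \<open>The two sides of s have lengths b = L - s and b = s, and each contributes b ln b - b + 1
  when b \<ge> 1. Replacing this by the tangent at L / 2 makes the sum independent of s.\<close>

lemma negative_potential_ge:
  assumes "2 \<le> L" "s \<in> {0..L}"
  shows "ennreal (ln (L / 2) - 1 + 2 / L) \<le>
    (\<integral>\<^sup>+z. e2ennreal (- log_kernel z (c + of_real s)) \<partial>segment_measure c L)"
proof -
  define h :: "real \<Rightarrow> real \<Rightarrow> ennreal" where "h b x = ennreal (ln x) * indicator {1..b} x" for b x
  have [measurable]: "h b \<in> borel_measurable borel" for b unfolding h_def by measurable
  have h: "ennreal (b * ln (L / 2) - L / 2 + 1) \<le> (\<integral>\<^sup>+x. h b x \<partial>lborel)" for b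
  proof (cases "1 \<le> b")
    case True
    then show ?thesis unfolding h_def
      using nn_integral_ln_ge_1[OF True] tangent_line_le_mult_ln[of b "L / 2"] assms(1)
      by (auto intro!: ennreal_leI)
  next
    case False
    \<comment> \<open>For b < 1 the claimed lower bound is not positive; 2 \<le> L makes the
      logarithm nonnegative.\<close>
    have "b * ln (L / 2) \<le> 1 * ln (L / 2)" using False assms(1) by (intro mult_right_mono) auto
    also have "\<dots> \<le> L / 2 - 1" using assms(1) ln_le_minus_one[of "L / 2"] by simp
    finally have "b * ln (L / 2) - L / 2 + 1 \<le> 0" by simp
    then show ?thesis by (simp add: ennreal_neg)
  qed
  have subadd: "ennreal (x + y) \<le> ennreal x + ennreal y" for x y
    by (auto simp: ennreal_plus_if intro!: ennreal_leI)
  have "L * (ln (L / 2) - 1 + 2 / L) = ((L - s) * ln (L / 2) - L / 2 + 1) + (s * ln (L / 2) - L / 2 + 1)"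
    using assms(1) by (simp add: algebra_simps)
  then have "ennreal (L * (ln (L / 2) - 1 + 2 / L)) \<le>
      ennreal ((L - s) * ln (L / 2) - L / 2 + 1) + ennreal (s * ln (L / 2) - L / 2 + 1)"
    by (simp only: subadd)
  also have "\<dots> \<le> (\<integral>\<^sup>+x. h (L - s) x \<partial>lborel) + (\<integral>\<^sup>+x. h s x \<partial>lborel)"
    by (intro add_mono h)
  also have "\<dots> = (\<integral>\<^sup>+t. h (L - s) (- s + 1 * t) + h s (s + (- 1) * t) \<partial>lborel)"
    using nn_integral_real_affine[of "h (L - s)" 1 "- s"] nn_integral_real_affine[of "h s" "- 1" s]
    by (subst nn_integral_add) auto
  also have "\<dots> \<le> (\<integral>\<^sup>+t. e2ennreal (- log_kernel (c + of_real t) (c + of_real s)) * indicator {0..L} t \<partial>lborel)"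
  proof (intro nn_integral_mono)
    fix t :: real
    show "h (L - s) (- s + 1 * t) + h s (s + (- 1) * t) \<le>
        e2ennreal (- log_kernel (c + of_real t) (c + of_real s)) * indicator {0..L} t"
    proof (cases "s = t")
      case False
      then have "e2ennreal (- log_kernel (c + of_real t) (c + of_real s)) = ennreal (ln \<bar>t - s\<bar>)"
        using log_kernel_segment[of s t c] by (simp add: ennreal_def)
      then show ?thesis using assms(2) by (auto simp: h_def indicator_def)
    qed (simp add: h_def)
  qed
  finally have "ennreal (L * (ln (L / 2) - 1 + 2 / L)) / ennreal L \<le>
      (\<integral>\<^sup>+z. e2ennreal (- log_kernel z (c + of_real s)) \<partial>segment_measure c L)"
    using assms(1) by (subst nn_integral_segment_measure) (auto intro: divide_right_mono_ennreal)
  moreover have "ennreal (L * (ln (L / 2) - 1 + 2 / L)) / ennreal L = ennreal (ln (L / 2) - 1 + 2 / L)"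
    using assms(1) by (cases "0 \<le> ln (L / 2) - 1 + 2 / L")
      (auto simp: divide_ennreal ennreal_neg mult_nonneg_nonpos)
  ultimately show ?thesis by simp
qed

text \<open>In the difference of the two potential bounds the terms 2 / L cancel.\<close>

lemma log_energy_segment_measure_le:
  assumes "2 \<le> L"
  shows "log_energy (segment_measure c L) \<le> ereal (1 - ln (L / 2))"
proof -
  let ?\<mu> = "segment_measure c L"
  interpret prob_space ?\<mu> using assms by (intro prob_space_segment_measure) simp
  have AE: "AE w in ?\<mu>. \<exists>s\<in>{0..L}. w = c + of_real s"
    using AE_segment_measure[of L c] assms by (auto simp: image_iff)
  have "(\<integral>\<^sup>+w. (\<integral>\<^sup>+z. e2ennreal (log_kernel z w) \<partial>?\<mu>) \<partial>?\<mu>) \<le> (\<integral>\<^sup>+w. ennreal (2 / L) \<partial>?\<mu>)"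
  proof (rule nn_integral_mono_AE, use AE in eventually_elim)
    case (elim w)
    then show ?case using positive_potential_le assms by auto
  qed
  then have pos: "enn2ereal (\<integral>\<^sup>+w. (\<integral>\<^sup>+z. e2ennreal (log_kernel z w) \<partial>?\<mu>) \<partial>?\<mu>) \<le> ereal (2 / L)"
    using assms by (simp add: emeasure_space_1 less_eq_ennreal.rep_eq)
  have "(\<integral>\<^sup>+w. ennreal (ln (L / 2) - 1 + 2 / L) \<partial>?\<mu>) \<le> (\<integral>\<^sup>+w. (\<integral>\<^sup>+z. e2ennreal (- log_kernel z w) \<partial>?\<mu>) \<partial>?\<mu>)"
  proof (rule nn_integral_mono_AE, use AE in eventually_elim)
    case (elim w)
    then show ?case using negative_potential_ge assms by auto
  qed
  then have "enn2ereal (ennreal (ln (L / 2) - 1 + 2 / L)) \<le>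
      enn2ereal (\<integral>\<^sup>+w. (\<integral>\<^sup>+z. e2ennreal (- log_kernel z w) \<partial>?\<mu>) \<partial>?\<mu>)"
    by (simp add: emeasure_space_1 less_eq_ennreal.rep_eq)
  moreover have "ereal (ln (L / 2) - 1 + 2 / L) \<le> enn2ereal (ennreal (ln (L / 2) - 1 + 2 / L))"
    by (simp add: ennreal.rep_eq)
  ultimately have "log_energy ?\<mu> \<le> ereal (2 / L) - ereal (ln (L / 2) - 1 + 2 / L)"
    unfolding log_energy_def using pos by (intro ereal_minus_mono) auto
  then show ?thesis by simp
qed

text \<open>On a bounded set the negative part of the kernel is at most the logarithm of a bound on
  distances, or 0.\<close>

lemma log_energy_bounded_below:
  assumes "compact E"
  obtains B :: real where "\<And>\<mu>. \<mu> \<in> prob_measures_on E \<Longrightarrow> ereal (- B) \<le> log_energy \<mu>"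
proof -
  have "bounded E" using assms by (rule compact_imp_bounded)
  then obtain r where r: "\<And>z. z \<in> E \<Longrightarrow> norm z \<le> r" by (auto simp: bounded_iff)
  define B where "B = max 0 (ln (2 * r))"
  have "0 \<le> B" by (simp add: B_def)
  have "ereal (- B) \<le> log_energy \<mu>" if \<mu>: "\<mu> \<in> prob_measures_on E" for \<mu>
  proof -
    interpret prob_space \<mu> using \<mu> by (simp add: prob_measures_on_def)
    have "- E \<in> sets \<mu>" using \<mu> assms by (auto simp: prob_measures_on_def compact_imp_closed)
    then have AE: "AE z in \<mu>. z \<in> E"
      using \<mu> by (intro AE_I[of _ _ "- E"]) (auto simp: prob_measures_on_def)
    have kernel: "e2ennreal (- log_kernel z w) \<le> ennreal B" if "z \<in> E" "w \<in> E" for z w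
    proof (cases "z = w")
      case True
      then show ?thesis by (simp add: log_kernel_def e2ennreal_neg)
    next
      case False
      have "norm (z - w) \<le> 2 * r"
        using norm_triangle_ineq4[of z w] r[OF that(1)] r[OF that(2)] by simp
      then have "ln (norm (z - w)) \<le> B"
        using False ln_mono[of "norm (z - w)" "2 * r"] by (simp add: B_def le_max_iff_disj)
      moreover have "e2ennreal (- log_kernel z w) = ennreal (ln (norm (z - w)))"
        using False by (simp add: log_kernel_def ln_div ennreal_def)
      ultimately show ?thesis by (simp add: ennreal_leI)
    qed
    have "(\<integral>\<^sup>+z. e2ennreal (- log_kernel z w) \<partial>\<mu>) \<le> ennreal B" if "w \<in> E" for w
    proof -
      have "(\<integral>\<^sup>+z. e2ennreal (- log_kernel z w) \<partial>\<mu>) \<le> (\<integral>\<^sup>+z. ennreal B \<partial>\<mu>)"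
        by (rule nn_integral_mono_AE, use AE in eventually_elim) (rule kernel[OF _ that])
      then show ?thesis by (simp add: emeasure_space_1)
    qed
    note potential = this
    have "(\<integral>\<^sup>+w. (\<integral>\<^sup>+z. e2ennreal (- log_kernel z w) \<partial>\<mu>) \<partial>\<mu>) \<le> (\<integral>\<^sup>+w. ennreal B \<partial>\<mu>)"
      by (rule nn_integral_mono_AE, use AE in eventually_elim) (rule potential)
    then have "enn2ereal (\<integral>\<^sup>+w. (\<integral>\<^sup>+z. e2ennreal (- log_kernel z w) \<partial>\<mu>) \<partial>\<mu>) \<le> ereal B"
      using \<open>0 \<le> B\<close> by (simp add: emeasure_space_1 less_eq_ennreal.rep_eq)
    then have "0 - ereal B \<le> log_energy \<mu>"
      unfolding log_energy_def by (intro ereal_minus_mono) auto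
    then show ?thesis by simp
  qed
  then show ?thesis by (rule that)
qed

text \<open>The bound C excludes \<infinity> and the bound -B excludes -\<infinity>; for finite
  values \<open>real_of_ereal\<close> preserves the order.\<close>

lemma log_capacity_ge:
  assumes "compact E" "\<mu> \<in> prob_measures_on E" "log_energy \<mu> \<le> ereal C"
  shows "exp (- C) \<le> log_capacity E"
proof -
  obtain B where B: "\<And>\<mu>. \<mu> \<in> prob_measures_on E \<Longrightarrow> ereal (- B) \<le> log_energy \<mu>"
    using log_energy_bounded_below[OF assms(1)] by blast
  have le: "robin_constant E \<le> ereal C"
    unfolding robin_constant_def using assms by (auto intro: INF_lower2)
  have "ereal (- B) \<le> robin_constant E"
    unfolding robin_constant_def by (rule INF_greatest) (rule B)
  with le obtain x where "robin_constant E = ereal x" by (cases "robin_constant E") auto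
  then show ?thesis using le by (simp add: log_capacity_def)
qed

lemma log_capacity_segment_ge:
  assumes E: "compact E" "(\<lambda>t. c + complex_of_real t) ` {0..L} \<subseteq> E" and L: "2 \<le> L"
  shows "L / 6 \<le> log_capacity E"
proof -
  let ?\<mu> = "segment_measure c L"
  have "AE w in ?\<mu>. w \<notin> - E"
    using AE_segment_measure[of L c] E(2) L by (auto elim!: AE_mp)
  moreover have "- E \<in> sets ?\<mu>"
    using E(1) by (auto simp: segment_measure_def compact_imp_closed)
  ultimately have "emeasure ?\<mu> (- E) = 0"
    by (subst (asm) AE_iff_measurable[of "- E"]) (auto simp: segment_measure_def)
  then have "?\<mu> \<in> prob_measures_on E"
    using prob_space_segment_measure[of L c] L by (simp add: prob_measures_on_def segment_measure_def)
  from log_capacity_ge[OF E(1) this log_energy_segment_measure_le[OF L]]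
  have "L / 2 / exp 1 \<le> log_capacity E" using L by (simp add: exp_diff)
  moreover have "L / 2 / 3 \<le> L / 2 / exp 1" using L exp_le by (intro divide_left_mono) auto
  ultimately show ?thesis by simp
qed

section \<open>The critical points\<close>

text \<open>The value of \<open>R\<^sub>p\<close> at a critical point \<open>p w\<close>, with \<open>\<tau>\<^sup>3 = a / p\<close> and \<open>\<delta> = p\<^sup>\<eta>\<^sup>-\<^sup>1\<close>.\<close>

lemma norm_less_one_at_critical_point:
  fixes \<tau> \<delta> :: real and w :: complex
  assumes \<tau>: "0 < \<tau>" "\<tau> \<le> 1 / 1000" and \<delta>: "40 * \<tau>\<^sup>2 < \<delta>" "\<delta> \<le> 1 / 2"
    and crit: "of_real (\<tau> ^ 3) * (1 + w\<^sup>2)\<^sup>2 + 2 * of_real (1 - \<delta>) * (w - 1) ^ 3 * (w + 1) = 0"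
    and w: "w\<^sup>2 + 1 \<noteq> 0" "w \<noteq> 1"
  shows "norm (of_real (\<tau> ^ 3) / (w - 1) + of_real (1 - \<delta>) * (2 * w / (w\<^sup>2 + 1))) < 1"
proof -
  \<comment> \<open>In absolute value the critical equation is \<tau>^3 n^2 = 2 (1 - \<delta>) x^3
    y; what follows are real inequalities in x, y and n.\<close>
  define x y n where "x = norm (w - 1)" and "y = norm (w + 1)" and "n = norm (w\<^sup>2 + 1)"
  have pos: "x > 0" "y \<ge> 0" "n > 0" using w by (auto simp: x_def y_def n_def)
  have xy: "2 \<le> x + y" "y \<le> x + 2" "x \<le> y + 2"
    using norm_triangle_ineq4[of "w + 1" "w - 1"] norm_triangle_ineq[of "w - 1" 2]
      norm_triangle_ineq4[of "w + 1" 2]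
    by (simp_all add: x_def y_def algebra_simps)
  have half: "w\<^sup>2 + 1 = ((w + 1)\<^sup>2 + (w - 1)\<^sup>2) / 2" by (simp add: field_simps power2_eq_square)
  have n_eq: "n = norm ((w + 1)\<^sup>2 + (w - 1)\<^sup>2) / 2" unfolding n_def half by (simp add: norm_divide)
  have n_le: "n \<le> (x\<^sup>2 + y\<^sup>2) / 2"
    unfolding n_eq x_def y_def using norm_triangle_ineq[of "(w + 1)\<^sup>2" "(w - 1)\<^sup>2"] by (simp add: norm_power)
  have n_ge: "n \<ge> (y\<^sup>2 - x\<^sup>2) / 2" "n \<ge> (x\<^sup>2 - y\<^sup>2) / 2"
    unfolding n_eq x_def y_def
    using norm_diff_ineq[of "(w + 1)\<^sup>2" "(w - 1)\<^sup>2"] norm_diff_ineq[of "(w - 1)\<^sup>2" "(w + 1)\<^sup>2"]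
    by (simp_all add: norm_power add.commute)
  have \<tau>3: "\<tau> ^ 3 \<le> \<tau>\<^sup>2 / 1000" "\<tau> ^ 3 > 0" "\<tau>\<^sup>2 \<le> 1 / 1000000"
    using \<tau> mult_left_mono[of \<tau> "1/1000" "\<tau>\<^sup>2"] power_mono[of \<tau> "1/1000" 2]
    by (simp_all add: power3_eq_cube power2_eq_square)
  have "of_real (\<tau> ^ 3) * (w\<^sup>2 + 1)\<^sup>2 = - (2 * of_real (1 - \<delta>) * (w - 1) ^ 3 * (w + 1))"
    using crit by (simp add: add_eq_0_iff add.commute)
  then have "norm (of_real (\<tau> ^ 3) * (w\<^sup>2 + 1)\<^sup>2) = norm (2 * of_real (1 - \<delta>) * (w - 1) ^ 3 * (w + 1))"
    by (metis norm_minus_cancel)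
  moreover have "norm (of_real (\<tau> ^ 3) * (w\<^sup>2 + 1)\<^sup>2) = \<tau> ^ 3 * n\<^sup>2"
    using \<tau> by (simp add: norm_mult norm_power n_def)
  moreover have "norm (2 * of_real (1 - \<delta>) * (w - 1) ^ 3 * (w + 1)) = 2 * (1 - \<delta>) * x ^ 3 * y"
    using \<delta> by (simp only: norm_mult norm_power x_def y_def norm_of_real) simp
  ultimately have main: "\<tau> ^ 3 * n\<^sup>2 = 2 * (1 - \<delta>) * (x ^ 3 * y)" by simp
  have xy0: "0 \<le> x ^ 3 * y" using pos by simp
  \<comment> \<open>As 1 \<le> 2 (1 - \<delta>) \<le> 2, the factor disappears at the cost of a
    constant.\<close>
  have upper: "x ^ 3 * y \<le> \<tau> ^ 3 * n\<^sup>2"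
    using mult_right_mono[of 1 "2 * (1 - \<delta>)" "x ^ 3 * y"] xy0 \<delta> main by simp
  have "0 < \<delta>" using \<delta>(1) by (smt (verit) zero_le_power2)
  then have lower: "\<tau> ^ 3 * n\<^sup>2 \<le> 2 * (x ^ 3 * y)"
    using mult_right_mono[of "2 * (1 - \<delta>)" 2 "x ^ 3 * y"] xy0 main by simp
  have tri: "norm (of_real (\<tau> ^ 3) / (w - 1) + of_real (1 - \<delta>) * (2 * w / (w\<^sup>2 + 1))) \<le>
      \<tau> ^ 3 / x + (1 - \<delta>) * norm (2 * w / (w\<^sup>2 + 1))"
    by (rule order.trans[OF norm_triangle_ineq])
      (use \<tau> \<delta> in \<open>simp add: norm_mult norm_divide norm_power x_def del: of_real_diff\<close>)
  \<comment> \<open>The two forms show the quadratic deviation from 1 near w = 1 and from -1 near w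
    = -1.\<close>
  have "2 * w / (w\<^sup>2 + 1) = 1 - (w - 1)\<^sup>2 / (w\<^sup>2 + 1)" "2 * w / (w\<^sup>2 + 1) = (w + 1)\<^sup>2 / (w\<^sup>2 + 1) - 1"
    using w by (simp_all add: field_simps power2_eq_square)
  from arg_cong[OF this(1), of norm] arg_cong[OF this(2), of norm]
  have J: "norm (2 * w / (w\<^sup>2 + 1)) \<le> 1 + x\<^sup>2 / n" "norm (2 * w / (w\<^sup>2 + 1)) \<le> 1 + y\<^sup>2 / n"
    using norm_triangle_ineq4[of 1 "(w - 1)\<^sup>2 / (w\<^sup>2 + 1)"] norm_triangle_ineq4[of "(w + 1)\<^sup>2 / (w\<^sup>2 + 1)" 1]
    by (simp_all add: norm_divide norm_power x_def y_def n_def)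
  show ?thesis
  proof (cases "x \<ge> 1")
    \<comment> \<open>Here w is close to -1: n = O(x^2) gives y = O(\<tau>^3 x), and x \<le> y + 2
      turns this into y \<le> 100 \<tau>^3. The total error 101 \<tau>^3 is far below
      \<delta>.\<close>
    case True
    have "n \<le> 5 * x\<^sup>2"
    proof -
      have "y\<^sup>2 \<le> (3 * x)\<^sup>2" using xy True pos by (intro power_mono) auto
      then show ?thesis using n_le by (simp add: power_mult_distrib)
    qed
    then have "n\<^sup>2 \<le> (5 * x\<^sup>2)\<^sup>2" using pos by (intro power_mono) auto
    then have "\<tau> ^ 3 * n\<^sup>2 \<le> \<tau> ^ 3 * (5 * x\<^sup>2)\<^sup>2" using \<tau> by (intro mult_left_mono) auto
    then have "x ^ 3 * y \<le> x ^ 3 * (25 * \<tau> ^ 3 * x)"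
      using upper by (simp add: power_mult_distrib power2_eq_square power3_eq_cube algebra_simps)
    then have "y \<le> 25 * \<tau> ^ 3 * x" using pos by simp
    moreover have "25 * \<tau> ^ 3 * x \<le> 25 * \<tau> ^ 3 * (y + 2)" using xy \<tau> by (intro mult_left_mono) auto
    moreover have "25 * \<tau> ^ 3 * y \<le> 1 / 2 * y" using pos \<tau>3 by (intro mult_right_mono) auto
    ultimately have y: "y \<le> 100 * \<tau> ^ 3" by (simp add: algebra_simps)
    have y1: "y \<le> 1 / 10" using y \<tau>3 by simp
    have "x\<^sup>2 \<ge> (19 / 10)\<^sup>2" using y1 xy by (intro power_mono) auto
    moreover have yy: "y\<^sup>2 \<le> y * 1" unfolding power2_eq_square using y1 pos by (intro mult_left_mono) auto
    ultimately have "n \<ge> 1" using n_ge(2) y1 by (simp add: power2_eq_square)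
    then have "y\<^sup>2 / n \<le> y" using yy pos mult_left_mono[of 1 n y] by (simp add: divide_le_eq)
    then have "norm (2 * w / (w\<^sup>2 + 1)) \<le> 1 + 100 * \<tau> ^ 3" using J y by simp
    then have "(1 - \<delta>) * norm (2 * w / (w\<^sup>2 + 1)) \<le> (1 - \<delta>) * (1 + 100 * \<tau> ^ 3)"
      using \<delta> by (intro mult_left_mono) auto
    also have "\<dots> \<le> 1 - \<delta> + 100 * \<tau> ^ 3"
      using \<open>0 < \<delta>\<close> \<tau>3 by (simp add: algebra_simps)
    moreover have "\<tau> ^ 3 / x \<le> \<tau> ^ 3" using True \<tau>3 by (simp add: divide_le_eq)
    ultimately show ?thesis using tri \<tau>3 \<delta> by linarith
  next
    \<comment> \<open>Here w is close to 1: y lies between 1 and 3 and n \<le> 5, so x^3 \<le> 25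
      \<tau>^3, rounded up to the cube of 3 \<tau>.\<close>
    case False
    have y: "1 \<le> y" "y \<le> 3" using False xy by auto
    have "x\<^sup>2 \<le> 1" using False pos by (simp add: power_le_one)
    moreover have "y\<^sup>2 \<le> 3\<^sup>2" using y by (intro power_mono) auto
    ultimately have "n \<le> 5" using n_le by simp
    then have "n\<^sup>2 \<le> 5\<^sup>2" using pos by (intro power_mono) auto
    then have "\<tau> ^ 3 * n\<^sup>2 \<le> \<tau> ^ 3 * 25" using \<tau>3 by (intro mult_left_mono) auto
    moreover have "x ^ 3 * 1 \<le> x ^ 3 * y" using y pos by (intro mult_left_mono) auto
    ultimately have "x ^ 3 \<le> 27 * \<tau> ^ 3" using upper \<tau>3 by linarith
    then have "x ^ 3 \<le> (3 * \<tau>) ^ 3" by (simp add: power_mult_distrib)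
    then have x: "x \<le> 3 * \<tau>" using \<tau> by (intro power_le_imp_le_base[of x 2]) (auto simp: numeral_3_eq_3)
    then have x2: "x\<^sup>2 \<le> 9 * \<tau>\<^sup>2" using power_mono[OF x, of 2] pos by (simp add: power_mult_distrib)
    have "(19 / 10)\<^sup>2 \<le> y\<^sup>2" using x xy \<tau> by (intro power_mono) auto
    then have n: "n \<ge> 3 / 2" using n_ge(1) x2 \<tau>3 by (simp add: power2_eq_square)
    have "(3 / 2)\<^sup>2 \<le> n\<^sup>2" using n by (intro power_mono) auto
    then have "\<tau> ^ 3 * 2 \<le> \<tau> ^ 3 * n\<^sup>2" using \<tau>3 by (intro mult_left_mono) (auto simp: power2_eq_square)
    moreover have "x ^ 3 * y \<le> x ^ 3 * 3" using y pos by (intro mult_left_mono) auto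
    \<comment> \<open>The converse comparison is needed because \<tau>^3 / x has x in the
      denominator.\<close>
    ultimately have "\<tau> ^ 3 \<le> 3 * x ^ 3" using lower by simp
    then have "\<tau> ^ 3 / x \<le> 3 * x\<^sup>2" using pos by (simp add: divide_le_eq power2_eq_square power3_eq_cube mult_ac)
    moreover have "x\<^sup>2 / n \<le> x\<^sup>2"
      using n pos mult_left_mono[of 1 n "x\<^sup>2"] by (simp add: divide_le_eq)
    then have "(1 - \<delta>) * norm (2 * w / (w\<^sup>2 + 1)) \<le> (1 - \<delta>) * (1 + x\<^sup>2)"
      using \<delta> J by (intro mult_left_mono) auto
    moreover have "(1 - \<delta>) * (1 + x\<^sup>2) \<le> 1 - \<delta> + x\<^sup>2"
      using \<open>0 < \<delta>\<close> by (simp add: algebra_simps)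
    \<comment> \<open>The errors 3 x^2 and x^2 add up to at most 36 \<tau>^2, whence the constant 40
      in the hypothesis on \<delta>.\<close>
    ultimately show ?thesis using tri x2 \<delta> zero_le_power2[of \<tau>] by linarith
  qed
qed

section \<open>The family\<close>

definition R_num :: "real \<Rightarrow> real \<Rightarrow> real \<Rightarrow> complex poly" where
  "R_num a k p = [:of_real (a * p\<^sup>2), of_real (- 2 * k * p), of_real (a + 2 * k):]"

definition R_den :: "real \<Rightarrow> complex poly" where
  "R_den p = [:of_real (- (p ^ 3)), of_real (p\<^sup>2), of_real (- p), 1:]"

lemma poly_R_num: "poly (R_num a k p) z =
    of_real a * (z\<^sup>2 + (of_real p)\<^sup>2) + 2 * of_real k * z * (z - of_real p)"
  by (simp add: R_num_def algebra_simps power2_eq_square)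

lemma poly_R_den: "poly (R_den p) z = (z - of_real p) * (z\<^sup>2 + (of_real p)\<^sup>2)"
  by (simp add: R_den_def algebra_simps power2_eq_square power3_eq_cube)

lemma degree_R_den: "degree (R_den p) = 3" "lead_coeff (R_den p) = 1"
  by (simp_all add: R_den_def)

lemma degree_R_num_less: "degree (R_num a k p) < degree (R_den p)"
proof -
  have "degree (R_num a k p) \<le> 2" unfolding R_num_def by (rule degree_le) (auto simp: coeff_pCons split: nat.splits)
  then show ?thesis by (simp add: degree_R_den)
qed

text \<open>This is -R' times the squared denominator. The poles at \<plusminus>ip combine to 2 k z
  / (z^2 + p^2), whose derivative has numerator 2 k (p^2 - z^2); this supplies the third factor z -
  p.\<close>

lemma poly_R_crit: "poly (pderiv (R_den p) * R_num a k p - R_den p * pderiv (R_num a k p)) z =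
    of_real a * (z\<^sup>2 + (of_real p)\<^sup>2)\<^sup>2 + 2 * of_real k * (z - of_real p) ^ 3 * (z + of_real p)"
  by (simp add: R_num_def R_den_def pderiv_pCons algebra_simps power2_eq_square power3_eq_cube)

lemma R_fam_eq_Fract: "R_fam a \<eta> p = Fract (R_num a (p - p powr \<eta>) p) (R_den p)"
proof -
  define k where "k = p - p powr \<eta>"
  define A B C where "A = [:- complex_of_real p, 1:]"
    and "B = [:- (\<i> * complex_of_real p), 1:]" and "C = [:\<i> * complex_of_real p, 1:]"
  have "R_fam a \<eta> p = Fract (([:of_real a:] * B + [:of_real k:] * A) * C + [:of_real k:] * (A * B)) (A * B * C)"
    unfolding R_fam_def A_def[symmetric] B_def[symmetric] C_def[symmetric] k_def[symmetric]
    by (simp add: A_def B_def C_def)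
  moreover have "([:of_real a:] * B + [:of_real k:] * A) * C + [:of_real k:] * (A * B) = R_num a k p"
    by (simp add: A_def B_def C_def R_num_def algebra_simps power2_eq_square)
  moreover have "A * B * C = R_den p"
    by (simp add: A_def B_def C_def R_den_def algebra_simps power2_eq_square power3_eq_cube)
  ultimately show ?thesis by (simp add: k_def)
qed

lemma R_num_den_no_common_root:
  assumes "0 < a" "0 < k" "0 < p" "poly (R_den p) z = 0"
  shows "poly (R_num a k p) z \<noteq> 0"
proof (cases "z = of_real p")
  case True
  then show ?thesis using assms by (simp add: poly_R_num)
next
  case False
  then have "z\<^sup>2 + (of_real p)\<^sup>2 = 0" using assms by (simp add: poly_R_den)
  then show ?thesis using assms False by (auto simp: poly_R_num)
qed

lemma R_noncritical:
  assumes p: "0 < p" and \<tau>: "0 < \<tau>" "\<tau> \<le> 1 / 1000" and \<delta>: "40 * \<tau>\<^sup>2 < \<delta>" "\<delta> \<le> 1 / 2"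
    and a: "a = p * \<tau> ^ 3" and k: "k = p * (1 - \<delta>)"
    and z: "norm (poly (R_den p) z) \<le> norm (poly (R_num a k p) z)"
  shows "poly (pderiv (R_den p) * R_num a k p - R_den p * pderiv (R_num a k p)) z \<noteq> 0"
proof
  assume "poly (pderiv (R_den p) * R_num a k p - R_den p * pderiv (R_num a k p)) z = 0"
  note crit = this[unfolded poly_R_crit]
  define w where "w = z / of_real p"
  have zw: "z = of_real p * w" using p by (simp add: w_def)
  have ak: "0 < a" "0 < k" using p \<tau> \<delta> by (simp_all add: a k)
  \<comment> \<open>With a and k both proportional to p, the substitution z = p w makes the equation
    homogeneous of degree 5 in p.\<close>
  have "of_real (p ^ 5) * (of_real (\<tau> ^ 3) * (1 + w\<^sup>2)\<^sup>2 + 2 * of_real (1 - \<delta>) * (w - 1) ^ 3 * (w + 1)) = 0"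
    using crit unfolding zw a k
    by (simp add: algebra_simps power2_eq_square power3_eq_cube eval_nat_numeral)
  then have crit_w: "of_real (\<tau> ^ 3) * (1 + w\<^sup>2)\<^sup>2 + 2 * of_real (1 - \<delta>) * (w - 1) ^ 3 * (w + 1) = 0"
    using p by simp
  \<comment> \<open>Poles are not critical: at w = 1 only 4 \<tau>^3 remains, and at w^2 = -1 only
    the second term, which is nonzero.\<close>
  have w1: "w \<noteq> 1" using crit_w \<tau> by auto
  have w2: "w\<^sup>2 + 1 \<noteq> 0"
  proof
    assume 0: "w\<^sup>2 + 1 = 0"
    then have "w \<noteq> - 1" by auto
    then have "w + 1 \<noteq> 0" by (simp add: add_eq_0_iff2)
    moreover have "complex_of_real (1 - \<delta>) \<noteq> 0" using \<delta> by (simp only: of_real_eq_0_iff)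
    ultimately show False using crit_w w1 0 by (simp add: add.commute del: of_real_diff)
  qed
  have den: "poly (R_den p) z = of_real (p ^ 3) * ((w - 1) * (w\<^sup>2 + 1))"
    by (simp add: poly_R_den zw algebra_simps power2_eq_square power3_eq_cube)
  have "poly (R_num a k p) z = of_real (p ^ 3) *
      (of_real (\<tau> ^ 3) * (w\<^sup>2 + 1) + of_real (1 - \<delta>) * (2 * w) * (w - 1))"
    by (simp add: poly_R_num zw a k algebra_simps power2_eq_square power3_eq_cube)
  moreover have "x * y * (A / x + B * (C / y)) = A * y + B * C * x"
    if "x \<noteq> 0" "y \<noteq> 0" for x y A B C :: complex
    using that by (simp add: field_simps)
  ultimately have num: "poly (R_num a k p) z = poly (R_den p) z *
      (of_real (\<tau> ^ 3) / (w - 1) + of_real (1 - \<delta>) * (2 * w / (w\<^sup>2 + 1)))"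
    unfolding den mult.assoc[of "of_real (p ^ 3)"] using w1 w2 by (metis right_minus_eq)
  have "poly (R_den p) z \<noteq> 0" unfolding den using p w1 w2 by simp
  then have "norm (poly (R_num a k p) z) < norm (poly (R_den p) z)"
    using mult_strict_left_mono[OF norm_less_one_at_critical_point[OF \<tau> \<delta> crit_w w2 w1]]
    unfolding num norm_mult by (metis mult.right_neutral zero_less_norm_iff)
  then show False using z by simp
qed

text \<open>Clearing denominators includes the pole t = 0. The difference of numerator and
  denominator is (x^2 + p^2) (a - \<delta> t) - (1 - \<delta>) t^3 with x = p + t. The bound on t
  leaves a - \<delta> t \<ge> a / 4, and a^2 \<le> \<delta>^3 p^2 makes the cubic term at most 27/64
  a p^2.\<close>

lemma R_ge_one_on_segment:
  assumes p: "0 < p" and \<delta>: "0 < \<delta>" "\<delta> \<le> 1" and a: "0 < a" "a\<^sup>2 \<le> \<delta> ^ 3 * p\<^sup>2"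
    and k: "k = p * (1 - \<delta>)" and t: "0 \<le> t" "t \<le> 3 / 4 * (a / \<delta>)"
  shows "norm (poly (R_den p) (of_real p + of_real t)) \<le> norm (poly (R_num a k p) (of_real p + of_real t))"
proof -
  define x where "x = p + t"
  define D N where "D = t * (x\<^sup>2 + p\<^sup>2)" and "N = a * (x\<^sup>2 + p\<^sup>2) + 2 * k * x * t"
  have "complex_of_real p + of_real t = of_real x" by (simp add: x_def)
  then have D: "poly (R_den p) (of_real p + of_real t) = of_real D"
    and N: "poly (R_num a k p) (of_real p + of_real t) = of_real N"
    by (simp_all add: poly_R_den poly_R_num D_def N_def x_def)
  have "N - D = (x\<^sup>2 + p\<^sup>2) * (a - \<delta> * t) - (1 - \<delta>) * t ^ 3"
    by (simp add: N_def D_def k x_def algebra_simps power2_eq_square power3_eq_cube)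
  moreover have "p\<^sup>2 * a / 2 \<le> (x\<^sup>2 + p\<^sup>2) * (a - \<delta> * t)"
  proof -
    have "2 * p\<^sup>2 * (a / 4) \<le> (x\<^sup>2 + p\<^sup>2) * (a - \<delta> * t)"
    proof (intro mult_mono)
      show "2 * p\<^sup>2 \<le> x\<^sup>2 + p\<^sup>2" using p t by (simp add: x_def power_mono)
      show "a / 4 \<le> a - \<delta> * t" using t \<delta> by (simp add: field_simps)
    qed (use a in auto)
    then show ?thesis by (simp add: mult.commute)
  qed
  moreover have "(1 - \<delta>) * t ^ 3 \<le> p\<^sup>2 * a / 2"
  proof -
    have "(1 - \<delta>) * t ^ 3 \<le> 1 * t ^ 3" using t \<delta> by (intro mult_right_mono) auto
    also have "\<dots> \<le> 1 * (3 / 4 * (a / \<delta>)) ^ 3" using t by (simp add: power_mono)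
    also have "\<dots> = 27 / 64 * (a * a\<^sup>2 / \<delta> ^ 3)"
      by (simp add: power_mult_distrib power_divide power2_eq_square power3_eq_cube)
    also have "\<dots> \<le> 27 / 64 * (a * p\<^sup>2)"
      using a \<delta> mult_left_mono[OF a(2), of a] by (simp add: divide_le_eq mult_ac)
    also have "\<dots> \<le> p\<^sup>2 * a / 2" using a by simp
    finally show ?thesis .
  qed
  ultimately have "D \<le> N" by linarith
  moreover have "0 \<le> D" using t by (simp add: D_def)
  ultimately show ?thesis unfolding D N by simp
qed

text \<open>The decisive comparison is p^(-2/3) against p^(\<eta> - 1), which is where \<eta> > 2/3
  enters; \<eta> < 1 makes \<delta> small and a / \<delta> large.\<close>

lemma parameters_eventually:
  fixes a \<eta> :: real
  assumes "a > 0" and "2 / 3 < \<eta>" and "\<eta> < 1"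
  shows "\<forall>\<^sub>F p in at_top. (a / p) powr (1 / 3) \<le> 1 / 1000 \<and>
    40 * ((a / p) powr (1 / 3))\<^sup>2 < p powr (\<eta> - 1) \<and> p powr (\<eta> - 1) \<le> 1 / 2 \<and>
    a\<^sup>2 \<le> (p powr (\<eta> - 1)) ^ 3 * p\<^sup>2 \<and> 2 \<le> 3 / 4 * (a / p powr (\<eta> - 1))"
  using assms by (intro eventually_conj; real_asymp)

theorem theorem4p6:
  fixes a \<eta> :: real
  assumes "a > 0" and "2 / 3 < \<eta>" and "\<eta> < 1"
  shows "\<exists>p0 \<ge> 1. \<forall>p > p0.
           good_rational 3 (R_fam a \<eta> p) \<and>
           log_capacity
             {z. Some z \<in> connected_component_of_set
                  (subtopology riemann_sphere {x. sphere_norm (rat_eval (R_fam a \<eta> p) x) \<ge> 1})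
                  (Some (of_real p))}
             \<ge> a * p powr (1 - \<eta>) / 8"
proof -
  obtain p0 where p0: "\<And>p. p \<ge> p0 \<Longrightarrow> (a / p) powr (1 / 3) \<le> 1 / 1000 \<and>
    40 * ((a / p) powr (1 / 3))\<^sup>2 < p powr (\<eta> - 1) \<and> p powr (\<eta> - 1) \<le> 1 / 2 \<and>
    a\<^sup>2 \<le> (p powr (\<eta> - 1)) ^ 3 * p\<^sup>2 \<and> 2 \<le> 3 / 4 * (a / p powr (\<eta> - 1))"
    using parameters_eventually[OF assms] by (auto simp: eventually_at_top_linorder)
  show ?thesis
  proof (intro exI[of _ "max p0 1"] conjI allI impI)
    fix p :: real assume "max p0 1 < p"
    then have p: "p > 0" "p \<ge> p0" by auto
    define \<tau> \<delta> k where "\<tau> = (a / p) powr (1 / 3)" and "\<delta> = p powr (\<eta> - 1)" and "k = p - p powr \<eta>"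
    \<comment> \<open>With the capacity bound L / 6, the factor 3/4 yields exactly a / (8
      \<delta>).\<close>
    define L where "L = 3 / 4 * (a / \<delta>)"
    have params: "\<tau> \<le> 1 / 1000" "40 * \<tau>\<^sup>2 < \<delta>" "\<delta> \<le> 1 / 2" "a\<^sup>2 \<le> \<delta> ^ 3 * p\<^sup>2" "2 \<le> L"
      using p0[OF p(2)] by (simp_all add: \<tau>_def \<delta>_def L_def)
    have \<tau>: "0 < \<tau>" using assms p by (simp add: \<tau>_def)
    have "\<tau> ^ 3 = a / p"
      using assms p by (simp add: \<tau>_def powr_power)
    then have a: "a = p * \<tau> ^ 3" using p by simp
    have \<delta>: "0 < \<delta>" using p by (simp add: \<delta>_def)
    have k: "k = p * (1 - \<delta>)"
      using p by (simp add: k_def \<delta>_def powr_diff right_diff_distrib)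
    then have "0 < k" using p params by simp
    note no_common_root = R_num_den_no_common_root[OF assms(1) \<open>0 < k\<close> p(1)]
    have R: "R_fam a \<eta> p = Fract (R_num a k p) (R_den p)"
      unfolding k_def by (rule R_fam_eq_Fract)
    show "good_rational 3 (R_fam a \<eta> p)"
      using good_rational_Fract[OF degree_R_num_less degree_R_den(2) no_common_root
          R_noncritical[OF p(1) \<tau> params(1-3) a k]]
      by (simp add: R degree_R_den)
    let ?S = "(\<lambda>t. complex_of_real p + of_real t) ` {0..L}"
    have S: "connected ?S" "of_real p \<in> ?S"
      using params by (auto intro!: connected_continuous_image continuous_intros image_eqI[of _ _ 0])
    have seg: "norm (poly (R_den p) z) \<le> norm (poly (R_num a k p) z)" if "z \<in> ?S" for z
      using that R_ge_one_on_segment[OF p(1) \<delta> _ assms(1) params(4) k] params(3) by (auto simp: L_def)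
    note comp = lemniscate_component[OF degree_R_num_less degree_R_den(2) no_common_root S seg]
    have "a * p powr (1 - \<eta>) / 8 = L / 6"
      using p by (simp add: L_def \<delta>_def powr_diff)
    then show "log_capacity
        {z. Some z \<in> connected_component_of_set
          (subtopology riemann_sphere {x. sphere_norm (rat_eval (R_fam a \<eta> p) x) \<ge> 1})
          (Some (of_real p))} \<ge> a * p powr (1 - \<eta>) / 8"
      using log_capacity_segment_ge[OF comp params(5)] by (simp only: R)
  qed simp
qed

end
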